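(* Let $G_3$ be the group generated by $f_1,\dots,f_6$ with multiplication of generators given by $$f_1^2=f_2^2=f_3^2=f_4^2=f_5^2=f_6^2=1,$$ $$f_2f_1=f_1f_2f_5,\quad f_3f_1=f_1f_3f_6,\quad f_3f_2=f_2f_3f_5,\quad f_4f_1=f_1f_4f_5,\quad f_4f_2=f_2f_4,\quad f_4f_3=f_3f_4,$$ with $f_5$ and $f_6$ commuting with all generators. Let $G_4$ be the group generated by $f_1,\dots,f_6$ with multiplication of generators given by $$f_1^2=1,\quad f_2^2=f_5,\quad f_3^2=f_4^2=f_5^2=f_6^2=1,$$ $$f_2f_1=f_1f_2f_5,\quad f_3f_1=f_1f_3f_6,\quad f_3f_2=f_2f_3f_5,\quad f_4f_1=f_1f_4f_5,\quad f_4f_2=f_2f_4,\quad f_4f_3=f_3f_4,$$ with $f_5$ and $f_6$ commuting with all generators. Then $G_3$ and $G_4$ (groups of order $64$) are not isomorphic as groups, but they are monoidally equivalent. The order lists of both groups are $$\mathrm{List}(G_3)=\mathrm{List}(G_4)=\{1,31,32,0,0,0,0\}.$$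
   Context: For a finite group $G$, $\mathrm{Rep}(G)$ denotes the $C^*$-tensor category of finite dimensional unitary representations of $G$, whose morphisms are intertwiners. Two finite groups $G$ and $H$ are called monoidally equivalent (or isocategorical) if $\mathrm{Rep}(G)$ and $\mathrm{Rep}(H)$ are equivalent as $C^*$-tensor categories (unitarily monoidally equivalent; no compatibility with the symmetric braidings or with the fiber functors is required). The order list of a finite group $G$ is the ordered tuple $\mathrm{List}(G)=\{D^{(d_1)},\dots,D^{(d_m)}\}$, where $d_1<\dots<d_m$ are the divisors of $|G|$ and $D^{(d)}$ is the number of elements of $G$ of order exactly $d$. For $|G|=64$ the divisors are $1,2,4,8,16,32,64$. The groups $G_3,G_4$ are those presented by the listed generators and relations (a polycyclic presentation of a group of order $64$, every element being uniquely $f_1^{a_1}\cdots f_6^{a_6}$ with $a_i\in\{0,1\}$). *)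

theory Defs
  imports
    "HOL-Algebra.Multiplicative_Group"
    "Jordan_Normal_Form.Schur_Decomposition"
begin

section \<open>Groups given by generators and relations\<close>

text \<open>A letter (x, True) stands for the generator x, a letter (x, False) for its inverse.\<close>

type_synonym 'x gword = "('x \<times> bool) list"

inductive pres_eq :: "('x gword \<times> 'x gword) set \<Rightarrow> 'x gword \<Rightarrow> 'x gword \<Rightarrow> bool"
  for R :: "('x gword \<times> 'x gword) set"
where
  refl: "pres_eq R u u"
| sym: "pres_eq R u v \<Longrightarrow> pres_eq R v u"
| trans: "pres_eq R u v \<Longrightarrow> pres_eq R v w \<Longrightarrow> pres_eq R u w"
| app: "pres_eq R u u' \<Longrightarrow> pres_eq R v v' \<Longrightarrow> pres_eq R (u @ v) (u' @ v')"
| cancel: "pres_eq R [(x, b), (x, \<not> b)] []"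
| rel: "(u, v) \<in> R \<Longrightarrow> pres_eq R u v"

definition pres_class :: "('x gword \<times> 'x gword) set \<Rightarrow> 'x gword \<Rightarrow> 'x gword set" where
  "pres_class R w = {v. pres_eq R w v}"

definition presented_group :: "('x gword \<times> 'x gword) set \<Rightarrow> 'x gword set monoid" where
  "presented_group R =
    \<lparr>carrier = range (pres_class R),
     monoid.mult = (\<lambda>X Y. {w. \<exists>u\<in>X. \<exists>v\<in>Y. pres_eq R (u @ v) w}),
     one = pres_class R []\<rparr>"

lemma pres_class_eq_iff: "pres_class R u = pres_class R v \<longleftrightarrow> pres_eq R u v"
  unfolding pres_class_def by (auto intro: pres_eq.refl pres_eq.sym pres_eq.trans)

lemma presented_group_mult:
  "pres_class R u \<otimes>\<^bsub>presented_group R\<^esub> pres_class R v = pres_class R (u @ v)"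
  unfolding presented_group_def pres_class_def
  by (auto intro: pres_eq.refl pres_eq.sym pres_eq.trans pres_eq.app)

lemma presented_group_carrier: "carrier (presented_group R) = range (pres_class R)"
  by (simp add: presented_group_def)

lemma presented_group_one: "\<one>\<^bsub>presented_group R\<^esub> = pres_class R []"
  by (simp add: presented_group_def)

lemma pres_eq_inverse:
  "pres_eq R (rev (map (\<lambda>(x, b). (x, \<not> b)) w) @ w) []"
proof (induction w)
  case Nil
  then show ?case by (simp add: pres_eq.refl)
next
  case (Cons a w)
  obtain x b where a: "a = (x, b)" by (cases a)
  let ?r = "rev (map (\<lambda>(x, b). (x, \<not> b)) w)"
  have "pres_eq R [(x, \<not> b), (x, b)] []"
    using pres_eq.cancel[of R x "\<not> b"] by simp
  then have "pres_eq R (?r @ ([(x, \<not> b), (x, b)] @ w)) (?r @ ([] @ w))"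
    by (intro pres_eq.app pres_eq.refl)
  then show ?case using Cons.IH pres_eq.trans a by force
qed

lemma group_presented_group: "group (presented_group R)"
proof (rule groupI)
  fix X assume "X \<in> carrier (presented_group R)"
  then obtain w where w: "X = pres_class R w" by (auto simp: presented_group_carrier)
  show "\<exists>Y\<in>carrier (presented_group R). Y \<otimes>\<^bsub>presented_group R\<^esub> X = \<one>\<^bsub>presented_group R\<^esub>"
    by (rule bexI[of _ "pres_class R (rev (map (\<lambda>(x, b). (x, \<not> b)) w))"])
      (auto simp: w presented_group_mult presented_group_one presented_group_carrier
        pres_class_eq_iff pres_eq_inverse)
qed (auto simp: presented_group_carrier presented_group_mult presented_group_one)


subsection \<open>The two groups\<close>

datatype gen = F1 | F2 | F3 | F4 | F5 | F6

definition positive_rels :: "('x list \<times> 'x list) set \<Rightarrow> ('x gword \<times> 'x gword) set" where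
  "positive_rels S =
    (\<lambda>(u, v). (map (\<lambda>x. (x, True)) u, map (\<lambda>x. (x, True)) v)) ` S"

definition rels_common :: "(gen list \<times> gen list) set" where
  "rels_common =
    {([F1, F1], []), ([F3, F3], []), ([F4, F4], []), ([F5, F5], []), ([F6, F6], []),
     ([F2, F1], [F1, F2, F5]), ([F3, F1], [F1, F3, F6]), ([F3, F2], [F2, F3, F5]),
     ([F4, F1], [F1, F4, F5]), ([F4, F2], [F2, F4]), ([F4, F3], [F3, F4])}
    \<union> {([c, x], [x, c]) |c x. c \<in> {F5, F6}}"

definition G3 :: "gen gword set monoid" where
  "G3 = presented_group (positive_rels (insert ([F2, F2], []) rels_common))"

definition G4 :: "gen gword set monoid" where
  "G4 = presented_group (positive_rels (insert ([F2, F2], [F5]) rels_common))"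


section \<open>Order lists\<close>

definition order_list :: "('a, 'b) monoid_scheme \<Rightarrow> nat list" where
  "order_list G =
    map (\<lambda>d. card {x \<in> carrier G. group.ord G x = d}) (sorted_list_of_set {d. d dvd Coset.order G})"


section \<open>Unitary monoidal equivalence\<close>

text \<open>
  The data of a (not necessarily strict) C*-tensor category. The morphisms of all hom spaces live
  in one type and hom spaces need not be disjoint, so the action of a functor on morphisms takes
  source and target as extra arguments. Composition is written in the
  order of functions: Comp C g f is g after f. The norm is not part of the data: as
  norm(f)^2 = norm(f* f) and the norm of the C*-algebra Hom(a, a) is determined by its *-algebra
  structure, it carries no information, and every *-preserving linear functor between
  C*-categories is automatically contractive (isometric if faithful).
\<close>

record ('o, 'm) tensor_category =
  Obj :: "'o set"
  Hom :: "'o \<Rightarrow> 'o \<Rightarrow> 'm set"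
  Id :: "'o \<Rightarrow> 'm"
  Comp :: "'m \<Rightarrow> 'm \<Rightarrow> 'm"
  Add :: "'m \<Rightarrow> 'm \<Rightarrow> 'm"
  Scale :: "complex \<Rightarrow> 'm \<Rightarrow> 'm"
  Adj :: "'m \<Rightarrow> 'm"
  TObj :: "'o \<Rightarrow> 'o \<Rightarrow> 'o"
  TMor :: "'m \<Rightarrow> 'm \<Rightarrow> 'm"
  Unit :: "'o"
  Assoc :: "'o \<Rightarrow> 'o \<Rightarrow> 'o \<Rightarrow> 'm"  \<comment> \<open>from (a b) c to a (b c)\<close>
  LUnit :: "'o \<Rightarrow> 'm"  \<comment> \<open>from 1 a to a\<close>
  RUnit :: "'o \<Rightarrow> 'm"  \<comment> \<open>from a 1 to a\<close>

definition unitary_mor :: "('o, 'm) tensor_category \<Rightarrow> 'o \<Rightarrow> 'o \<Rightarrow> 'm \<Rightarrow> bool" where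
  "unitary_mor C a b u \<longleftrightarrow>
    u \<in> Hom C a b \<and> Comp C (Adj C u) u = Id C a \<and> Comp C u (Adj C u) = Id C b"

definition star_functor ::
  "('o, 'm) tensor_category \<Rightarrow> ('p, 'n) tensor_category \<Rightarrow>
   ('o \<Rightarrow> 'p) \<Rightarrow> ('o \<Rightarrow> 'o \<Rightarrow> 'm \<Rightarrow> 'n) \<Rightarrow> bool"
where
  "star_functor C D F Fm \<longleftrightarrow>
    (\<forall>a\<in>Obj C. F a \<in> Obj D) \<and>
    (\<forall>a\<in>Obj C. \<forall>b\<in>Obj C. \<forall>f\<in>Hom C a b. Fm a b f \<in> Hom D (F a) (F b)) \<and>
    (\<forall>a\<in>Obj C. Fm a a (Id C a) = Id D (F a)) \<and>
    (\<forall>a\<in>Obj C. \<forall>b\<in>Obj C. \<forall>c\<in>Obj C. \<forall>f\<in>Hom C a b. \<forall>g\<in>Hom C b c.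
      Fm a c (Comp C g f) = Comp D (Fm b c g) (Fm a b f)) \<and>
    (\<forall>a\<in>Obj C. \<forall>b\<in>Obj C. \<forall>f\<in>Hom C a b. \<forall>g\<in>Hom C a b.
      Fm a b (Add C f g) = Add D (Fm a b f) (Fm a b g)) \<and>
    (\<forall>a\<in>Obj C. \<forall>b\<in>Obj C. \<forall>f\<in>Hom C a b. \<forall>z.
      Fm a b (Scale C z f) = Scale D z (Fm a b f)) \<and>
    (\<forall>a\<in>Obj C. \<forall>b\<in>Obj C. \<forall>f\<in>Hom C a b. Fm b a (Adj C f) = Adj D (Fm a b f))"

definition unitary_tensor_functor ::
  "('o, 'm) tensor_category \<Rightarrow> ('p, 'n) tensor_category \<Rightarrow>
   ('o \<Rightarrow> 'p) \<Rightarrow> ('o \<Rightarrow> 'o \<Rightarrow> 'm \<Rightarrow> 'n) \<Rightarrow> 'n \<Rightarrow> ('o \<Rightarrow> 'o \<Rightarrow> 'n) \<Rightarrow> bool"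
where
  "unitary_tensor_functor C D F Fm \<iota> J \<longleftrightarrow>
    star_functor C D F Fm \<and>
    unitary_mor D (Unit D) (F (Unit C)) \<iota> \<and>
    (\<forall>a\<in>Obj C. \<forall>b\<in>Obj C. unitary_mor D (TObj D (F a) (F b)) (F (TObj C a b)) (J a b)) \<and>
    (\<forall>a\<in>Obj C. \<forall>b\<in>Obj C. \<forall>a'\<in>Obj C. \<forall>b'\<in>Obj C. \<forall>f\<in>Hom C a a'. \<forall>g\<in>Hom C b b'.
      Comp D (J a' b') (TMor D (Fm a a' f) (Fm b b' g)) =
      Comp D (Fm (TObj C a b) (TObj C a' b') (TMor C f g)) (J a b)) \<and>
    (\<forall>a\<in>Obj C. \<forall>b\<in>Obj C. \<forall>c\<in>Obj C.
      Comp D (Fm (TObj C (TObj C a b) c) (TObj C a (TObj C b c)) (Assoc C a b c))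
        (Comp D (J (TObj C a b) c) (TMor D (J a b) (Id D (F c)))) =
      Comp D (J a (TObj C b c))
        (Comp D (TMor D (Id D (F a)) (J b c)) (Assoc D (F a) (F b) (F c)))) \<and>
    (\<forall>a\<in>Obj C.
      Comp D (Fm (TObj C (Unit C) a) a (LUnit C a))
        (Comp D (J (Unit C) a) (TMor D \<iota> (Id D (F a)))) = LUnit D (F a)) \<and>
    (\<forall>a\<in>Obj C.
      Comp D (Fm (TObj C a (Unit C)) a (RUnit C a))
        (Comp D (J a (Unit C)) (TMor D (Id D (F a)) \<iota>)) = RUnit D (F a))"

definition unitarily_monoidally_equivalent ::
  "('o, 'm) tensor_category \<Rightarrow> ('p, 'n) tensor_category \<Rightarrow> bool"
where
  "unitarily_monoidally_equivalent C D \<longleftrightarrow>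
    (\<exists>F Fm \<iota> J.
      unitary_tensor_functor C D F Fm \<iota> J \<and>
      (\<forall>a\<in>Obj C. \<forall>b\<in>Obj C. bij_betw (Fm a b) (Hom C a b) (Hom D (F a) (F b))) \<and>
      (\<forall>y\<in>Obj D. \<exists>x\<in>Obj C. \<exists>u. unitary_mor D (F x) y u))"


section \<open>The C*-tensor category of finite dimensional unitary representations\<close>

definition kron :: "'a::times mat \<Rightarrow> 'a mat \<Rightarrow> 'a mat" where
  "kron A B = mat (dim_row A * dim_row B) (dim_col A * dim_col B)
    (\<lambda>(i, j). A $$ (i div dim_row B, j div dim_col B) * B $$ (i mod dim_row B, j mod dim_col B))"

definition unitary_group :: "nat \<Rightarrow> complex mat monoid" where
  "unitary_group n =
    \<lparr>carrier = {U \<in> carrier_mat n n. mat_adjoint U * U = 1\<^sub>m n \<and> U * mat_adjoint U = 1\<^sub>m n},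
     monoid.mult = (*),
     one = 1\<^sub>m n\<rparr>"

text \<open>
  A finite dimensional Hilbert space is represented by the coordinate space of column vectors of
  length n, so an object is a pair (n, rho) with rho a homomorphism into the n by n unitary
  matrices (n = 0 is allowed). The tensor product is the Kronecker product: the basis vector
  with index i * m + j of the tensor product of spaces of dimensions n and m is the tensor product
  of the i-th and the j-th one. With this indexing the canonical associators and unitors are
  identity matrices (see kron_assoc, kron_one_left and kron_one_right).
\<close>

type_synonym 'g urep = "nat \<times> ('g \<Rightarrow> complex mat)"

definition Rep :: "('g, 'b) monoid_scheme \<Rightarrow> ('g urep, complex mat) tensor_category" where
  "Rep G =
    \<lparr>Obj = {(n, \<rho>). \<rho> \<in> hom G (unitary_group n) \<inter> extensional (carrier G)},
     Hom = (\<lambda>(n, \<rho>) (m, \<sigma>).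
       {T \<in> carrier_mat m n. \<forall>g\<in>carrier G. T * \<rho> g = \<sigma> g * T}),
     Id = (\<lambda>(n, \<rho>). 1\<^sub>m n),
     Comp = (*),
     Add = (+),
     Scale = (\<cdot>\<^sub>m),
     Adj = mat_adjoint,
     TObj = (\<lambda>(n, \<rho>) (m, \<sigma>). (n * m, \<lambda>g\<in>carrier G. kron (\<rho> g) (\<sigma> g))),
     TMor = kron,
     Unit = (1, \<lambda>g\<in>carrier G. 1\<^sub>m 1),
     Assoc = (\<lambda>(n, \<rho>) (m, \<sigma>) (k, \<tau>). 1\<^sub>m (n * m * k)),
     LUnit = (\<lambda>(n, \<rho>). 1\<^sub>m n),
     RUnit = (\<lambda>(n, \<rho>). 1\<^sub>m n)\<rparr>"

definition monoidally_equivalent ::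
  "('g, 'b) monoid_scheme \<Rightarrow> ('h, 'c) monoid_scheme \<Rightarrow> bool"
where
  "monoidally_equivalent G H \<longleftrightarrow> unitarily_monoidally_equivalent (Rep G) (Rep H)"


subsection \<open>Basic properties of the Kronecker product\<close>

lemma dim_kron [simp]:
  "dim_row (kron A B) = dim_row A * dim_row B" "dim_col (kron A B) = dim_col A * dim_col B"
  by (simp_all add: kron_def)

lemma kron_carrier [simp]:
  "A \<in> carrier_mat n m \<Longrightarrow> B \<in> carrier_mat k l \<Longrightarrow> kron A B \<in> carrier_mat (n * k) (m * l)"
  by auto

lemma index_kron:
  assumes "i < dim_row A * dim_row B" "j < dim_col A * dim_col B"
  shows "kron A B $$ (i, j) =
    A $$ (i div dim_row B, j div dim_col B) * B $$ (i mod dim_row B, j mod dim_col B)"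
  using assms by (simp add: kron_def)

lemma div_mod_bounds:
  fixes i n m :: nat
  assumes "i < n * m"
  shows "i div m < n" "i mod m < m"
proof -
  have "m > 0" using assms by (cases m) auto
  then show "i div m < n" "i mod m < m"
    using assms by (simp_all add: less_mult_imp_div_less)
qed

lemma mod_mult_div: "(i mod (m * k)) div k = (i div k) mod (m::nat)"
  by (cases "k = 0") (simp_all add: mult.commute[of m k] mod_mult2_eq)

lemma kron_assoc:
  fixes A B C :: "'a::semigroup_mult mat"
  shows "kron (kron A B) C = kron A (kron B C)"
proof (rule eq_matI)
  fix i j
  assume "i < dim_row (kron A (kron B C))" "j < dim_col (kron A (kron B C))"
  then have i: "i < dim_row A * dim_row B * dim_row C" and j: "j < dim_col A * dim_col B * dim_col C"
    by (simp_all add: mult.assoc)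
  then have i': "i < dim_row A * (dim_row B * dim_row C)"
    and j': "j < dim_col A * (dim_col B * dim_col C)"
    by (simp_all add: mult.assoc)
  have ij: "i div dim_row C < dim_row A * dim_row B" "j div dim_col C < dim_col A * dim_col B"
    using div_mod_bounds(1) i j by auto
  have ij': "i mod (dim_row B * dim_row C) < dim_row B * dim_row C"
    "j mod (dim_col B * dim_col C) < dim_col B * dim_col C"
    using div_mod_bounds(2) i' j' by auto
  have mm: "i mod (dim_row B * dim_row C) mod dim_row C = i mod dim_row C"
    "j mod (dim_col B * dim_col C) mod dim_col C = j mod dim_col C"
    by (simp_all add: mod_mod_cancel)
  have dd: "i div dim_row C div dim_row B = i div (dim_row B * dim_row C)"
    "j div dim_col C div dim_col B = j div (dim_col B * dim_col C)"
    by (simp_all add: div_mult2_eq[symmetric] mult.commute)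
  have l: "kron (kron A B) C $$ (i, j) =
      kron A B $$ (i div dim_row C, j div dim_col C) * C $$ (i mod dim_row C, j mod dim_col C)"
    using i j by (subst index_kron) simp_all
  have r: "kron A (kron B C) $$ (i, j) =
      A $$ (i div (dim_row B * dim_row C), j div (dim_col B * dim_col C)) *
      kron B C $$ (i mod (dim_row B * dim_row C), j mod (dim_col B * dim_col C))"
    using i' j' by (subst index_kron) simp_all
  show "kron (kron A B) C $$ (i, j) = kron A (kron B C) $$ (i, j)"
    unfolding l r index_kron[OF ij] index_kron[OF ij'] mm dd mod_mult_div by (simp add: mult.assoc)
qed (simp_all add: mult.assoc)

lemma kron_one_left: "kron (1\<^sub>m 1) (A :: 'a::semiring_1 mat) = A"
  by (rule eq_matI) (auto simp: kron_def)

lemma kron_one_right: "kron (A :: 'a::semiring_1 mat) (1\<^sub>m 1) = A"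
  by (rule eq_matI) (auto simp: kron_def)

lemma kron_one: "kron (1\<^sub>m n) (1\<^sub>m m) = (1\<^sub>m (n * m) :: 'a::semiring_1 mat)"
proof (rule eq_matI)
  fix i j assume "i < dim_row (1\<^sub>m (n * m) :: 'a mat)" "j < dim_col (1\<^sub>m (n * m) :: 'a mat)"
  then have "i < n * m" "j < n * m" by simp_all
  moreover have "i = j \<longleftrightarrow> i div m = j div m \<and> i mod m = j mod m"
    by (metis div_mult_mod_eq)
  ultimately show "kron (1\<^sub>m n) (1\<^sub>m m) $$ (i, j) = (1\<^sub>m (n * m) :: 'a mat) $$ (i, j)"
    by (auto simp: index_kron div_mod_bounds)
qed simp_all

lemma sum_div_mod:
  fixes f :: "nat \<Rightarrow> nat \<Rightarrow> 'a::comm_monoid_add"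
  shows "(\<Sum>k<n * m. f (k div m) (k mod m)) = (\<Sum>i<n. \<Sum>j<m. f i j)"
proof -
  have "(\<Sum>i<n. \<Sum>j<m. f i j) = (\<Sum>(i, j)\<in>{..<n} \<times> {..<m}. f i j)"
    by (simp add: sum.cartesian_product)
  also have "\<dots> = (\<Sum>k<n * m. f (k div m) (k mod m))"
  proof (rule sum.reindex_bij_witness[where i = "\<lambda>k. (k div m, k mod m)" and j = "\<lambda>(i, j). i * m + j"])
    fix a assume "a \<in> {..<n} \<times> {..<m}"
    then obtain i j where a: "a = (i, j)" "i < n" "j < m" by auto
    have "i * m + j < Suc i * m" using a by simp
    also have "\<dots> \<le> n * m" using a by (intro mult_right_mono) auto
    finally show "(case a of (i, j) \<Rightarrow> i * m + j) \<in> {..<n * m}" by (simp add: a)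
  qed (auto simp: div_mod_bounds)
  finally show ?thesis by simp
qed

lemma kron_mult:
  fixes A B C D :: "'a::comm_semiring_0 mat"
  assumes "A \<in> carrier_mat a b" "C \<in> carrier_mat b c" "B \<in> carrier_mat k l" "D \<in> carrier_mat l m"
  shows "kron A B * kron C D = kron (A * C) (B * D)"
proof (rule eq_matI)
  fix i j assume "i < dim_row (kron (A * C) (B * D))" "j < dim_col (kron (A * C) (B * D))"
  then have i: "i < a * k" and j: "j < c * m" using assms by auto
  note ij = div_mod_bounds[OF i] div_mod_bounds[OF j]
  have "(kron A B * kron C D) $$ (i, j) = (\<Sum>t<b * l. kron A B $$ (i, t) * kron C D $$ (t, j))"
    using assms i j by (simp add: scalar_prod_def atLeast0LessThan)
  also have "\<dots> = (\<Sum>t<b * l. (A $$ (i div k, t div l) * C $$ (t div l, j div m)) *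
      (B $$ (i mod k, t mod l) * D $$ (t mod l, j mod m)))"
    using assms i j by (intro sum.cong) (auto simp: index_kron ac_simps)
  also have "\<dots> = (\<Sum>s<b. \<Sum>t<l. (A $$ (i div k, s) * C $$ (s, j div m)) *
      (B $$ (i mod k, t) * D $$ (t, j mod m)))"
    by (rule sum_div_mod)
  also have "\<dots> = (\<Sum>s<b. A $$ (i div k, s) * C $$ (s, j div m)) *
      (\<Sum>t<l. B $$ (i mod k, t) * D $$ (t, j mod m))"
    by (simp add: sum_product)
  also have "\<dots> = kron (A * C) (B * D) $$ (i, j)"
    using assms i j ij by (simp add: index_kron scalar_prod_def atLeast0LessThan)
  finally show "(kron A B * kron C D) $$ (i, j) = kron (A * C) (B * D) $$ (i, j)" .
qed (use assms in auto)

lemma dim_mat_adjoint [simp]: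
  "dim_row (mat_adjoint A) = dim_col A" "dim_col (mat_adjoint A) = dim_row A"
  by (simp_all add: mat_adjoint_def)

lemma index_mat_adjoint:
  "i < dim_col A \<Longrightarrow> j < dim_row A \<Longrightarrow> mat_adjoint A $$ (i, j) = conjugate (A $$ (j, i))"
  by (simp add: mat_adjoint_def mat_of_rows_def)

lemma mat_adjoint_kron: "mat_adjoint (kron A B) = kron (mat_adjoint A) (mat_adjoint (B :: complex mat))"
  by (rule eq_matI) (auto simp: index_mat_adjoint index_kron div_mod_bounds)

lemma TObj_Rep:
  assumes "x \<in> Obj (Rep G)" "y \<in> Obj (Rep G)" "group G"
  shows "TObj (Rep G) x y \<in> Obj (Rep G)"
proof -
  interpret group G by fact
  obtain n \<rho> m \<sigma> where xy: "x = (n, \<rho>)" "y = (m, \<sigma>)" by (cases x, cases y)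
  have h: "\<rho> \<in> hom G (unitary_group n)" "\<sigma> \<in> hom G (unitary_group m)"
    using assms by (auto simp: xy Rep_def)
  have c: "\<rho> g \<in> carrier_mat n n" "\<sigma> g \<in> carrier_mat m m"
    "mat_adjoint (\<rho> g) \<in> carrier_mat n n" "mat_adjoint (\<sigma> g) \<in> carrier_mat m m"
    "mat_adjoint (\<rho> g) * \<rho> g = 1\<^sub>m n" "mat_adjoint (\<sigma> g) * \<sigma> g = 1\<^sub>m m"
    "\<rho> g * mat_adjoint (\<rho> g) = 1\<^sub>m n" "\<sigma> g * mat_adjoint (\<sigma> g) = 1\<^sub>m m"
    if "g \<in> carrier G" for g
  proof -
    have u: "\<rho> g \<in> carrier (unitary_group n)" "\<sigma> g \<in> carrier (unitary_group m)"
      using h that by (auto simp: hom_def)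
    then show "\<rho> g \<in> carrier_mat n n" "\<sigma> g \<in> carrier_mat m m"
      "mat_adjoint (\<rho> g) * \<rho> g = 1\<^sub>m n" "mat_adjoint (\<sigma> g) * \<sigma> g = 1\<^sub>m m"
      "\<rho> g * mat_adjoint (\<rho> g) = 1\<^sub>m n" "\<sigma> g * mat_adjoint (\<sigma> g) = 1\<^sub>m m"
      by (simp_all add: unitary_group_def)
    then show "mat_adjoint (\<rho> g) \<in> carrier_mat n n" "mat_adjoint (\<sigma> g) \<in> carrier_mat m m"
      by (intro carrier_matI; simp)+
  qed
  have "kron (\<rho> g) (\<sigma> g) \<in> carrier (unitary_group (n * m))" if g: "g \<in> carrier G" for g
    using kron_mult[OF c(1)[OF g] c(3)[OF g] c(2)[OF g] c(4)[OF g]]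
      kron_mult[OF c(3)[OF g] c(1)[OF g] c(4)[OF g] c(2)[OF g]] c[OF g]
    by (simp add: unitary_group_def mat_adjoint_kron kron_one)
  moreover have "kron (\<rho> (g \<otimes>\<^bsub>G\<^esub> h')) (\<sigma> (g \<otimes>\<^bsub>G\<^esub> h')) = kron (\<rho> g) (\<sigma> g) * kron (\<rho> h') (\<sigma> h')"
    if "g \<in> carrier G" "h' \<in> carrier G" for g h'
    using h that kron_mult[OF c(1)[OF that(1)] c(1)[OF that(2)] c(2)[OF that(1)] c(2)[OF that(2)]]
    by (simp add: hom_def unitary_group_def)
  ultimately show ?thesis
    by (simp add: xy Rep_def hom_def unitary_group_def)
qed

lemma TMor_Rep:
  assumes "x \<in> Obj (Rep G)" "y \<in> Obj (Rep G)" "x' \<in> Obj (Rep G)" "y' \<in> Obj (Rep G)"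
    and "S \<in> Hom (Rep G) x x'" "T \<in> Hom (Rep G) y y'"
  shows "TMor (Rep G) S T \<in> Hom (Rep G) (TObj (Rep G) x y) (TObj (Rep G) x' y')"
proof -
  obtain n \<rho> m \<sigma> n' \<rho>' m' \<sigma>' where
    e: "x = (n, \<rho>)" "y = (m, \<sigma>)" "x' = (n', \<rho>')" "y' = (m', \<sigma>')"
    by (cases x, cases y, cases x', cases y')
  have c: "\<rho> g \<in> carrier_mat n n" "\<sigma> g \<in> carrier_mat m m"
    "\<rho>' g \<in> carrier_mat n' n'" "\<sigma>' g \<in> carrier_mat m' m'" if "g \<in> carrier G" for g
    using assms(1-4) that by (auto simp: e Rep_def hom_def unitary_group_def Pi_def)
  have S: "S \<in> carrier_mat n' n" "T \<in> carrier_mat m' m"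
    "\<And>g. g \<in> carrier G \<Longrightarrow> S * \<rho> g = \<rho>' g * S" "\<And>g. g \<in> carrier G \<Longrightarrow> T * \<sigma> g = \<sigma>' g * T"
    using assms(5,6) by (auto simp: e Rep_def)
  have "kron S T * kron (\<rho> g) (\<sigma> g) = kron (\<rho>' g) (\<sigma>' g) * kron S T"
    if "g \<in> carrier G" for g
    using kron_mult[OF S(1) c(1)[OF that] S(2) c(2)[OF that]]
      kron_mult[OF c(3)[OF that] S(1) c(4)[OF that] S(2)] S(3,4)[OF that] by simp
  then show ?thesis
    using S(1,2) by (simp add: e Rep_def)
qed

end

theory Submission
  imports Defs
begin

text \<open>
  The two groups only differ in \<open>f\<^sub>2\<^sup>2\<close>, which is 1 in \<open>G\<^sub>3\<close> and the central involution \<open>f\<^sub>5\<close> in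
  \<open>G\<^sub>4\<close>. Let \<open>Z = (1 + \<i>)/2 + (1 - \<i>)/2 f\<^sub>5\<close>, a central unitary square root of \<open>f\<^sub>5\<close> in the group
  algebra. Replacing \<open>\<rho>(f\<^sub>2)\<close> by \<open>\<rho>(f\<^sub>2) \<rho>(Z)\<close> turns a unitary representation of \<open>G\<^sub>3\<close> into one of
  \<open>G\<^sub>4\<close> on the same space, with the same intertwiners, and this is undone by the inverse of \<open>Z\<close>. As \<open>Z\<close>
  is not group-like, tensor products are only preserved up to a unitary \<open>J\<close>, namely the
  image of a bicharacter 2-cocycle on the dual of the normal subgroup generated by
  \<open>f\<^sub>3, f\<^sub>4, f\<^sub>5, f\<^sub>6\<close>.

  The groups are told apart by \<open>f\<^sub>1 \<in> G\<^sub>4\<close>, which commutes with exactly 8 solutions of \<open>y\<^sup>2 = 1\<close>; no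
  solution of \<open>x\<^sup>2 = 1\<close> in \<open>G\<^sub>3\<close> does.
\<close>

section \<open>Words and presented groups\<close>

definition gen_class :: "('x gword \<times> 'x gword) set \<Rightarrow> 'x \<Rightarrow> 'x gword set" where
  "gen_class R x = pres_class R [(x, True)]"

fun word_val :: "('a, 'b) monoid_scheme \<Rightarrow> ('x \<Rightarrow> 'a) \<Rightarrow> 'x gword \<Rightarrow> 'a" where
  "word_val K f [] = \<one>\<^bsub>K\<^esub>"
| "word_val K f ((x, b) # w) = (if b then f x else inv\<^bsub>K\<^esub> f x) \<otimes>\<^bsub>K\<^esub> word_val K f w"

lemma gen_class_closed [simp]: "gen_class R x \<in> carrier (presented_group R)"
  by (simp add: gen_class_def presented_group_carrier)

context group
begin

lemma word_val_closed [simp]: "range f \<subseteq> carrier G \<Longrightarrow> word_val G f w \<in> carrier G"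
  by (induction w) (auto simp: image_subset_iff)

lemma word_val_append:
  "range f \<subseteq> carrier G \<Longrightarrow> word_val G f (u @ v) = word_val G f u \<otimes> word_val G f v"
  by (induction u) (auto simp: image_subset_iff m_assoc)

lemma word_val_pres_eq:
  assumes f: "range f \<subseteq> carrier G"
    and R: "\<forall>(u, v)\<in>R. word_val G f u = word_val G f v"
    and "pres_eq R u v"
  shows "word_val G f u = word_val G f v"
  using assms(3)
proof (induction rule: pres_eq.induct)
  case (cancel x b)
  have "f x \<in> carrier G" using f by auto
  then show ?case by auto
next
  case (rel u v)
  then show ?case using R by auto
qed (simp_all add: word_val_append f)

text \<open>Uniqueness half of the universal property. The class of an inverse letter is the group
  inverse of \<open>gen_class\<close>, so the homomorphism laws carry an induction over
  words.\<close>

lemma hom_presented_group_eq_word_val: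
  assumes "\<phi> \<in> hom (presented_group R) G"
  shows "\<phi> (pres_class R w) = word_val G (\<lambda>x. \<phi> (gen_class R x)) w"
proof -
  let ?P = "presented_group R"
  interpret P: group ?P by (rule group_presented_group)
  interpret h: group_hom ?P G \<phi>
    by (intro group_hom.intro group_hom_axioms.intro assms P.is_group is_group)
  have inv: "pres_class R [(x, False)] = inv\<^bsub>?P\<^esub> gen_class R x" for x
    by (rule P.inv_equality[symmetric])
      (use pres_eq.cancel[of R x False] in \<open>auto simp: gen_class_def presented_group_mult
        presented_group_one presented_group_carrier pres_class_eq_iff\<close>)
  have pc: "pres_class R u \<in> carrier ?P" for u by (simp add: presented_group_carrier)
  show ?thesis
  proof (induction w)
    case Nil
    show ?case using h.hom_one by (simp add: presented_group_one)
  next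
    case (Cons a w)
    obtain x b where a: "a = (x, b)" by (cases a)
    have "pres_class R (a # w) = pres_class R [(x, b)] \<otimes>\<^bsub>?P\<^esub> pres_class R w"
      by (simp add: presented_group_mult a)
    also have "pres_class R [(x, b)] = (if b then gen_class R x else inv\<^bsub>?P\<^esub> gen_class R x)"
      by (auto simp: inv gen_class_def)
    finally have "\<phi> (pres_class R (a # w)) =
        \<phi> (if b then gen_class R x else inv\<^bsub>?P\<^esub> gen_class R x) \<otimes> \<phi> (pres_class R w)"
      by (simp add: pc)
    then show ?case
      using Cons.IH by (simp add: a)
  qed
qed

end

text \<open>The identity homomorphism is put into the previous lemma, so that results about
  evaluated words apply to the presented group itself.\<close>

lemma pres_class_eq_word_val: "pres_class R w = word_val (presented_group R) (gen_class R) w"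
  using group.hom_presented_group_eq_word_val[OF group_presented_group, of "\<lambda>X. X" R R w]
  by (simp add: hom_def)

text \<open>Existence half of the universal property; the chosen representative does not matter once
  the relations hold in \<open>K\<close>. Restricting to the carrier makes the lift extensional, as
  objects of \<open>Rep\<close> must be.\<close>

definition pres_lift ::
  "('x gword \<times> 'x gword) set \<Rightarrow> ('a, 'b) monoid_scheme \<Rightarrow> ('x \<Rightarrow> 'a) \<Rightarrow> 'x gword set \<Rightarrow> 'a"
where
  "pres_lift R K f = (\<lambda>X\<in>carrier (presented_group R). word_val K f (SOME w. w \<in> X))"

context group
begin

context
  fixes R :: "('x gword \<times> 'x gword) set" and f :: "'x \<Rightarrow> 'a"
  assumes f: "range f \<subseteq> carrier G"
    and R: "\<forall>(u, v)\<in>R. word_val G f u = word_val G f v"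
begin

lemma pres_lift_class: "pres_lift R G f (pres_class R w) = word_val G f w"
proof -
  have "w \<in> pres_class R w" by (simp add: pres_class_def pres_eq.refl)
  then have "(SOME v. v \<in> pres_class R w) \<in> pres_class R w" by (rule someI)
  then have "word_val G f (SOME v. v \<in> pres_class R w) = word_val G f w"
    using word_val_pres_eq[OF f R] by (auto simp: pres_class_def)
  then show ?thesis by (simp add: pres_lift_def presented_group_carrier)
qed

lemma pres_lift_gen_class: "pres_lift R G f (gen_class R x) = f x"
proof -
  have "f x \<in> carrier G" using f by auto
  then show ?thesis by (simp add: gen_class_def pres_lift_class)
qed

lemma pres_lift_hom: "pres_lift R G f \<in> hom (presented_group R) G"
  by (rule homI)
    (auto simp: presented_group_carrier presented_group_mult pres_lift_class word_val_append f)

end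

end

lemma pres_lift_extensional: "pres_lift R K f \<in> extensional (carrier (presented_group R))"
  by (simp add: pres_lift_def)


section \<open>The two groups as a family\<close>

text \<open>The flag is False for \<open>G\<^sub>3\<close> and True for \<open>G\<^sub>4\<close>; it decides whether \<open>f\<^sub>2\<^sup>2\<close> is 1 or \<open>f\<^sub>5\<close>.\<close>

definition G_rels :: "bool \<Rightarrow> (gen gword \<times> gen gword) set" where
  "G_rels t = positive_rels (insert ([F2, F2], if t then [F5] else []) rels_common)"

abbreviation Gp :: "bool \<Rightarrow> gen gword set monoid" where
  "Gp t \<equiv> presented_group (G_rels t)"

lemma G3_eq: "G3 = Gp False" and G4_eq: "G4 = Gp True"
  by (simp_all add: G3_def G4_def G_rels_def)

text \<open>Products are nested to the right as in \<open>word_val\<close>, so the equations can be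
  checked in a concrete group and also serve as rewrite rules.\<close>

definition satisfies_rels :: "bool \<Rightarrow> ('a, 'b) monoid_scheme \<Rightarrow> (gen \<Rightarrow> 'a) \<Rightarrow> bool" where
  "satisfies_rels t K f \<longleftrightarrow>
    (\<forall>x. x \<noteq> F2 \<longrightarrow> f x \<otimes>\<^bsub>K\<^esub> f x = \<one>\<^bsub>K\<^esub>) \<and>
    f F2 \<otimes>\<^bsub>K\<^esub> f F2 = (if t then f F5 else \<one>\<^bsub>K\<^esub>) \<and>
    f F2 \<otimes>\<^bsub>K\<^esub> f F1 = f F1 \<otimes>\<^bsub>K\<^esub> (f F2 \<otimes>\<^bsub>K\<^esub> f F5) \<and>
    f F3 \<otimes>\<^bsub>K\<^esub> f F1 = f F1 \<otimes>\<^bsub>K\<^esub> (f F3 \<otimes>\<^bsub>K\<^esub> f F6) \<and>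
    f F3 \<otimes>\<^bsub>K\<^esub> f F2 = f F2 \<otimes>\<^bsub>K\<^esub> (f F3 \<otimes>\<^bsub>K\<^esub> f F5) \<and>
    f F4 \<otimes>\<^bsub>K\<^esub> f F1 = f F1 \<otimes>\<^bsub>K\<^esub> (f F4 \<otimes>\<^bsub>K\<^esub> f F5) \<and>
    f F4 \<otimes>\<^bsub>K\<^esub> f F2 = f F2 \<otimes>\<^bsub>K\<^esub> f F4 \<and>
    f F4 \<otimes>\<^bsub>K\<^esub> f F3 = f F3 \<otimes>\<^bsub>K\<^esub> f F4 \<and>
    (\<forall>x. f F5 \<otimes>\<^bsub>K\<^esub> f x = f x \<otimes>\<^bsub>K\<^esub> f F5) \<and>
    (\<forall>x. f F6 \<otimes>\<^bsub>K\<^esub> f x = f x \<otimes>\<^bsub>K\<^esub> f F6)"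

lemma all_gen: "(\<forall>x. P x) \<longleftrightarrow> P F1 \<and> P F2 \<and> P F3 \<and> P F4 \<and> P F5 \<and> P F6"
  by (metis gen.exhaust)

lemma (in group) satisfies_rels_iff:
  assumes "range f \<subseteq> carrier G"
  shows "(\<forall>(u, v)\<in>G_rels t. word_val G f u = word_val G f v) \<longleftrightarrow> satisfies_rels t G f"
proof -
  have f: "f x \<in> carrier G" for x using assms by auto
  \<comment> \<open>These facts turn quantification over the relation set into a conjunction over
    its members.\<close>
  have *: "(\<forall>p\<in>{([c, x], [x, c]) |c x. c \<in> C}. P p) \<longleftrightarrow> (\<forall>c\<in>C. \<forall>x. P ([c, x], [x, c]))"
    for C :: "gen set" and P by auto
  have **: "(\<forall>p\<in>h ` A. P p) \<longleftrightarrow> (\<forall>p\<in>A. P (h p))" for h :: "'p \<Rightarrow> 'q" and A P by auto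
  have ***: "(\<forall>p\<in>insert a A. P p) \<longleftrightarrow> P a \<and> (\<forall>p\<in>A. P p)" for a :: 'p and A P by auto
  show ?thesis
    unfolding satisfies_rels_def G_rels_def positive_rels_def rels_common_def ** *** ball_Un *
    by (cases t) (simp_all add: f all_gen,
        (rule iffI; elim conjE; intro conjI; assumption)+)
qed

lemma satisfies_rels_hom:
  assumes "group K" "\<phi> \<in> hom (Gp t) K"
  shows "satisfies_rels t K (\<lambda>x. \<phi> (gen_class (G_rels t) x))"
proof -
  interpret group K by fact
  have r: "range (\<lambda>x. \<phi> (gen_class (G_rels t) x)) \<subseteq> carrier K"
    using assms(2) by (auto simp: hom_def)
  show ?thesis
  proof (rule satisfies_rels_iff[OF r, THEN iffD1], clarify)
    fix u v assume "(u, v) \<in> G_rels t"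
    then have "pres_class (G_rels t) u = pres_class (G_rels t) v"
      by (simp add: pres_class_eq_iff pres_eq.rel)
    then show "word_val K (\<lambda>x. \<phi> (gen_class (G_rels t) x)) u =
        word_val K (\<lambda>x. \<phi> (gen_class (G_rels t) x)) v"
      using hom_presented_group_eq_word_val[OF assms(2)] by metis
  qed
qed


section \<open>The polycyclic model\<close>

text \<open>
  A tuple \<open>(a\<^sub>1, \<dots>, a\<^sub>6)\<close> stands for the normal form \<open>f\<^sub>1^a\<^sub>1 \<dots> f\<^sub>6^a\<^sub>6\<close>, and \<open>\<noteq>\<close> on bool is addition
  modulo 2. The quadratic terms of the product are the commutators picked up when the letters are
  sorted, and \<open>t \<and> a2 \<and> b2\<close> comes from \<open>f\<^sub>2\<^sup>2\<close>.
\<close>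

type_synonym bits = "bool \<times> bool \<times> bool \<times> bool \<times> bool \<times> bool"

fun bits_mult :: "bool \<Rightarrow> bits \<Rightarrow> bits \<Rightarrow> bits" where
  "bits_mult t (a1, a2, a3, a4, a5, a6) (b1, b2, b3, b4, b5, b6) =
    (a1 \<noteq> b1, a2 \<noteq> b2, a3 \<noteq> b3, a4 \<noteq> b4,
     (a5 \<noteq> b5) \<noteq> (((a2 \<and> b1) \<noteq> (a3 \<and> b2)) \<noteq> ((a4 \<and> b1) \<noteq> (t \<and> a2 \<and> b2))),
     (a6 \<noteq> b6) \<noteq> (a3 \<and> b1))"

abbreviation bits_one :: bits where
  "bits_one \<equiv> (False, False, False, False, False, False)"

definition bits_group :: "bool \<Rightarrow> bits monoid" where
  "bits_group t = \<lparr>carrier = UNIV, monoid.mult = bits_mult t, one = bits_one\<rparr>"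

lemma bits_group_simps [simp]:
  "carrier (bits_group t) = UNIV" "x \<otimes>\<^bsub>bits_group t\<^esub> y = bits_mult t x y"
  "\<one>\<^bsub>bits_group t\<^esub> = bits_one"
  by (simp_all add: bits_group_def)

lemma group_bits_group: "group (bits_group t)"
proof (rule groupI)
  fix x y z :: bits
  show "x \<otimes>\<^bsub>bits_group t\<^esub> y \<otimes>\<^bsub>bits_group t\<^esub> z = x \<otimes>\<^bsub>bits_group t\<^esub> (y \<otimes>\<^bsub>bits_group t\<^esub> z)"
  proof -
    obtain a1 a2 a3 a4 a5 a6 where x: "x = (a1, a2, a3, a4, a5, a6)" by (cases x)
    obtain b1 b2 b3 b4 b5 b6 where y: "y = (b1, b2, b3, b4, b5, b6)" by (cases y)
    obtain c1 c2 c3 c4 c5 c6 where z: "z = (c1, c2, c3, c4, c5, c6)" by (cases z)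
    show ?thesis
      unfolding x y z
      \<comment> \<open>Only the bits occurring in quadratic terms of the triple product are split;
        all others enter additively.\<close>
      by (cases a2; cases a3; cases a4; cases b1; cases b2; cases b3; cases b4;
          cases c1; cases c2; cases t)
        (simp_all, blast+)
  qed
next
  fix x :: bits
  obtain a1 a2 a3 a4 a5 a6 where x: "x = (a1, a2, a3, a4, a5, a6)" by (cases x)
  show "\<exists>y\<in>carrier (bits_group t). y \<otimes>\<^bsub>bits_group t\<^esub> x = \<one>\<^bsub>bits_group t\<^esub>"
    \<comment> \<open>The inverse has the same first four exponents; the last two are corrected by
      the quadratic terms of \<open>x\<close> times \<open>x\<close>.\<close>
    by (rule bexI[of _ "(a1, a2, a3, a4,
      a5 \<noteq> (((a2 \<and> a1) \<noteq> (a3 \<and> a2)) \<noteq> ((a4 \<and> a1) \<noteq> (t \<and> a2))), a6 \<noteq> (a3 \<and> a1))"])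
      (auto simp: x)
qed auto

fun bits_gen :: "gen \<Rightarrow> bits" where
  "bits_gen F1 = (True, False, False, False, False, False)"
| "bits_gen F2 = (False, True, False, False, False, False)"
| "bits_gen F3 = (False, False, True, False, False, False)"
| "bits_gen F4 = (False, False, False, True, False, False)"
| "bits_gen F5 = (False, False, False, False, True, False)"
| "bits_gen F6 = (False, False, False, False, False, True)"

lemma satisfies_rels_bits_gen: "satisfies_rels t (bits_group t) bits_gen"
  unfolding satisfies_rels_def all_gen by (cases t) simp_all

fun normal_word :: "bits \<Rightarrow> gen gword" where
  "normal_word (a1, a2, a3, a4, a5, a6) =
    (if a1 then [(F1, True)] else []) @ (if a2 then [(F2, True)] else []) @
    (if a3 then [(F3, True)] else []) @ (if a4 then [(F4, True)] else []) @
    (if a5 then [(F5, True)] else []) @ (if a6 then [(F6, True)] else [])"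

context group
begin

context
  fixes t and f :: "gen \<Rightarrow> 'a"
  assumes f: "range f \<subseteq> carrier G" and rels: "satisfies_rels t G f"
begin

text \<open>Collection: the relations move the new letter to its place, and the commutators and
  squares produced on the way are the correction terms of \<open>bits_mult\<close>. Once the
  generator, the flag and the 64 normal forms are split, this is pure rewriting.\<close>

lemma gen_mult_normal_word:
  "f x \<otimes> word_val G f (normal_word m) = word_val G f (normal_word (bits_mult t (bits_gen x) m))"
proof -
  have c [simp]: "f y \<in> carrier G" for y using f by auto
  note r = rels[unfolded satisfies_rels_def]
  from r have inv_all: "\<forall>y. y \<noteq> F2 \<longrightarrow> f y \<otimes> f y = \<one>"
    and sqF2: "f F2 \<otimes> f F2 = (if t then f F5 else \<one>)"
    and comm3: "f F2 \<otimes> f F1 = f F1 \<otimes> (f F2 \<otimes> f F5)" "f F3 \<otimes> f F1 = f F1 \<otimes> (f F3 \<otimes> f F6)"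
      "f F3 \<otimes> f F2 = f F2 \<otimes> (f F3 \<otimes> f F5)" "f F4 \<otimes> f F1 = f F1 \<otimes> (f F4 \<otimes> f F5)"
    and comm: "f F4 \<otimes> f F2 = f F2 \<otimes> f F4" "f F4 \<otimes> f F3 = f F3 \<otimes> f F4"
    and central_all: "\<forall>y. f F5 \<otimes> f y = f y \<otimes> f F5" "\<forall>y. f F6 \<otimes> f y = f y \<otimes> f F6"
    by - (elim conjE, assumption)+
  note inv = inv_all[rule_format] and central = central_all[rule_format]
  note comm = comm central(1)[of F1] central(1)[of F2] central(1)[of F3] central(1)[of F4] central(2)[of F1]
    central(2)[of F2] central(2)[of F3] central(2)[of F4] central(2)[of F5]
  \<comment> \<open>The relations are restated with an arbitrary right factor \<open>w\<close>, so
    that adjacent letters can be rewritten inside right-nested products.\<close>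
  have swap: "f y \<otimes> (f z \<otimes> w) = f z \<otimes> (f y \<otimes> w)"
    if "f y \<otimes> f z = f z \<otimes> f y" "w \<in> carrier G" for y z w
    using that by (metis c m_assoc)
  have swap3: "f y \<otimes> (f z \<otimes> w) = f z \<otimes> (f y \<otimes> (f u \<otimes> w))"
    if "f y \<otimes> f z = f z \<otimes> (f y \<otimes> f u)" "w \<in> carrier G" for y z u w
    using that by (simp add: m_assoc[symmetric])
  have sq: "f y \<otimes> (f y \<otimes> w) = w" if "f y \<otimes> f y = \<one>" "w \<in> carrier G" for y w
    using that by (simp add: m_assoc[symmetric])
  have sq2: "f F2 \<otimes> (f F2 \<otimes> w) = (if t then f F5 \<otimes> w else w)" if "w \<in> carrier G" for w
    using that sqF2 inv by (simp add: m_assoc[symmetric])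
  note rules = inv comm3 comm sq2 comm3[THEN swap3] comm[THEN swap] sq[OF inv] sqF2
  obtain a1 a2 a3 a4 a5 a6 where m: "m = (a1, a2, a3, a4, a5, a6)" by (cases m)
  show ?thesis
    unfolding m
    by (cases x; cases t; cases a1; cases a2; cases a3; cases a4; cases a5; cases a6)
      (simp_all add: rules)
qed

text \<open>Collecting letter by letter, the value of a word depends only on its value in the model.
  For the presented group itself this gives injectivity of \<open>to_bits\<close>.\<close>

lemma word_val_eq_normal_word:
  "word_val G f w = word_val G f (normal_word (word_val (bits_group t) bits_gen w))"
proof (induction w)
  case (Cons a w)
  interpret B: group "bits_group t" by (rule group_bits_group)
  obtain x b where a: "a = (x, b)" by (cases a)
  have c: "f x \<in> carrier G" using f by auto
  let ?m = "word_val (bits_group t) bits_gen w"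
  let ?m' = "inv\<^bsub>bits_group t\<^esub> bits_gen x \<otimes>\<^bsub>bits_group t\<^esub> ?m"
  \<comment> \<open>An inverse letter is reduced to a positive one: multiplying \<open>?m'\<close>
    by the generator returns \<open>?m\<close>, and the equation is solved for the inverse.\<close>
  have "f x \<otimes> word_val G f (normal_word ?m') =
      word_val G f (normal_word (bits_gen x \<otimes>\<^bsub>bits_group t\<^esub> ?m'))"
    using gen_mult_normal_word by simp
  also have "bits_gen x \<otimes>\<^bsub>bits_group t\<^esub> ?m' = ?m"
    by (subst B.m_assoc[symmetric]) (simp_all del: bits_group_simps(2,3) add: B.r_inv)
  finally have "inv f x \<otimes> word_val G f (normal_word ?m) = word_val G f (normal_word ?m')"
    using c f by (simp add: inv_solve_left')
  then show ?case
    using Cons gen_mult_normal_word by (simp add: a)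
qed simp

end

end

definition to_bits :: "bool \<Rightarrow> gen gword set \<Rightarrow> bits" where
  "to_bits t = pres_lift (G_rels t) (bits_group t) bits_gen"

text \<open>\<open>n\<close> recovers a class from its tuple, so the presentation yields no more
  than the 64 normal forms; \<open>s\<close> shows that each tuple is hit by its normal word, so
  these do not collapse.\<close>

lemma to_bits_iso: "to_bits t \<in> iso (Gp t) (bits_group t)"
proof -
  interpret B: group "bits_group t" by (rule group_bits_group)
  interpret P: group "Gp t" by (rule group_presented_group)
  let ?R = "G_rels t" and ?g = "gen_class (G_rels t)"
  have r: "\<forall>(u, v)\<in>?R. word_val (bits_group t) bits_gen u = word_val (bits_group t) bits_gen v"
    using B.satisfies_rels_iff[of bits_gen t] satisfies_rels_bits_gen by simp
  have v: "to_bits t (pres_class ?R w) = word_val (bits_group t) bits_gen w" for w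
    unfolding to_bits_def by (rule B.pres_lift_class[OF _ r]) simp
  have rg: "satisfies_rels t (Gp t) ?g"
    using satisfies_rels_hom[OF P.is_group, of "\<lambda>X. X" t] by (simp add: hom_def)
  have n: "pres_class ?R w = pres_class ?R (normal_word (to_bits t (pres_class ?R w)))" for w
    unfolding v using P.word_val_eq_normal_word[OF _ rg, of w]
    by (simp add: pres_class_eq_word_val image_subset_iff)
  have s: "to_bits t (pres_class ?R (normal_word m)) = m" for m
    unfolding v by (cases m) simp
  have "inj_on (to_bits t) (carrier (Gp t))"
    by (rule inj_onI) (metis n presented_group_carrier rangeE)
  moreover have "to_bits t ` carrier (Gp t) = UNIV"
    using s by (metis UNIV_eq_I image_eqI presented_group_carrier rangeI)
  moreover have "to_bits t \<in> hom (Gp t) (bits_group t)"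
    unfolding to_bits_def by (rule B.pres_lift_hom[OF _ r]) simp
  ultimately show ?thesis by (simp add: iso_def bij_betw_def)
qed


section \<open>Orders and non-isomorphism\<close>

lemma card_Collect_bij_betw:
  assumes "bij_betw \<phi> A B" "\<And>x. x \<in> A \<Longrightarrow> P x \<longleftrightarrow> Q (\<phi> x)"
  shows "card {x \<in> A. P x} = card {y \<in> B. Q y}"
proof (rule bij_betw_same_card[of \<phi>], rule bij_betw_imageI)
  show "inj_on \<phi> {x \<in> A. P x}"
    using assms(1) by (auto simp: bij_betw_def inj_on_def)
  show "\<phi> ` {x \<in> A. P x} = {y \<in> B. Q y}"
    using assms by (force simp: bij_betw_def)
qed

lemma iso_pow_eq_one_iff:
  assumes "group G" "group H" "\<phi> \<in> iso G H" "x \<in> carrier G"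
  shows "x [^]\<^bsub>G\<^esub> (n::nat) = \<one>\<^bsub>G\<^esub> \<longleftrightarrow> \<phi> x [^]\<^bsub>H\<^esub> n = \<one>\<^bsub>H\<^esub>"
proof -
  interpret G: group G by fact
  interpret H: group H by fact
  interpret h: group_hom G H \<phi>
    using assms(3) by unfold_locales (simp add: iso_def)
  have inj: "inj_on \<phi> (carrier G)"
    using assms(3) by (simp add: iso_def bij_betw_def)
  show ?thesis
    using inj_onD[OF inj, of "x [^]\<^bsub>G\<^esub> n" "\<one>\<^bsub>G\<^esub>"] assms(4) h.hom_nat_pow[of x n] by auto
qed

lemma iso_ord_eq:
  assumes "group G" "group H" "\<phi> \<in> iso G H" "x \<in> carrier G"
  shows "group.ord H (\<phi> x) = group.ord G x"
proof -
  have "\<phi> x \<in> carrier H" using assms(3,4) by (auto simp: iso_def hom_def)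
  then have "group.ord H (\<phi> x) dvd n \<longleftrightarrow> group.ord G x dvd n" for n
    using iso_pow_eq_one_iff[OF assms, of n] group.pow_eq_id[OF assms(1,4), of n]
      group.pow_eq_id[OF assms(2), of "\<phi> x" n] by simp
  then show ?thesis by (metis dvd_antisym dvd_refl)
qed

lemma order_list_iso:
  assumes "group G" "group H" "\<phi> \<in> iso G H"
  shows "order_list G = order_list H"
proof -
  have bij: "bij_betw \<phi> (carrier G) (carrier H)"
    using assms(3) by (simp add: iso_def)
  have "card {x \<in> carrier G. group.ord G x = d} = card {x \<in> carrier H. group.ord H x = d}" for d
    by (rule card_Collect_bij_betw[OF bij]) (simp add: iso_ord_eq[OF assms])
  moreover have "Coset.order G = Coset.order H"
    using bij by (simp add: Coset.order_def bij_betw_same_card)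
  ultimately show ?thesis by (simp add: order_list_def)
qed

section \<open>Element orders in the model\<close>

lemma order_bits_group: "Coset.order (bits_group t) = 64"
  by (simp add: Coset.order_def card_cartesian_product flip: UNIV_Times_UNIV)

lemma bits_pow2: "x [^]\<^bsub>bits_group t\<^esub> (2::nat) = bits_mult t x x"
  by (cases x) (simp add: numeral_2_eq_2 nat_pow_def)

lemma card_square_one: "card {x. bits_mult t x x = bits_one} = 32"
proof -
  have "card {x. bits_mult False x x = bits_one} = 32" by code_simp
  moreover have "card {x. bits_mult True x x = bits_one} = 32" by code_simp
  ultimately show ?thesis by (cases t) simp_all
qed

lemma divisors_64: "sorted_list_of_set {d::nat. d dvd 64} = [1, 2, 4, 8, 16, 32, 64]"
proof -
  have "d \<in> {1, 2, 4, 8, 16, 32, 64} \<longleftrightarrow> d dvd 64" for d :: nat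
  proof -
    have "d dvd 2 ^ 6 \<longleftrightarrow> (\<exists>i\<le>6. d = 2 ^ i)"
      by (rule divides_primepow_nat) simp
    also have "\<dots> \<longleftrightarrow> d \<in> (\<lambda>i. 2 ^ i) ` {..6}" by auto
    also have "{..6::nat} = {0, 1, 2, 3, 4, 5, 6}" by auto
    finally show ?thesis by simp
  qed
  then have "{d::nat. d dvd 64} = {1, 2, 4, 8, 16, 32, 64}" by blast
  then show ?thesis by simp
qed

text \<open>Squares only involve \<open>f5\<close> and \<open>f6\<close>, so fourth powers are
  trivial and all orders are 1, 2 or 4. The counts then follow from the 32 elements of square 1,
  identity included.\<close>

lemma order_list_bits_group: "order_list (bits_group t) = [1, 31, 32, 0, 0, 0, 0]"
proof -
  interpret B: group "bits_group t" by (rule group_bits_group)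
  let ?S = "{x. bits_mult t x x = bits_one}"
  have pow4: "x [^]\<^bsub>bits_group t\<^esub> (4::nat) = bits_one" for x
  proof -
    have "x [^]\<^bsub>bits_group t\<^esub> (2 * 2 :: nat) = bits_mult t (bits_mult t x x) (bits_mult t x x)"
      by (subst B.nat_pow_pow[symmetric]) (simp_all only: bits_pow2 bits_group_simps UNIV_I)
    then show ?thesis by (cases x) simp
  qed
  have ord4: "B.ord x dvd 4" for x
    using B.pow_eq_id[of x 4] pow4 by simp
  have ord2: "B.ord x dvd 2 \<longleftrightarrow> x \<in> ?S" for x
    using B.pow_eq_id[of x 2] bits_pow2 by simp
  have ord1: "B.ord x = 1 \<longleftrightarrow> x = bits_one" for x
    using B.ord_eq_1[of x] by simp
  have dvd4: "d = 1 \<or> d = 2 \<or> d = 4" if "d dvd 4" for d :: nat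
  proof -
    have "d \<le> 4" using that by (rule dvd_imp_le) simp
    then have "d \<in> {0, 1, 2, 3, 4}" by auto
    then show ?thesis using that by auto
  qed
  have ord_cases: "B.ord x = (if x = bits_one then 1 else if x \<in> ?S then 2 else 4)" for x
    using dvd4[OF ord4[of x]] ord2[of x] ord1[of x] by auto
  have "{x. B.ord x = 1} = {bits_one}" "{x. B.ord x = 2} = ?S - {bits_one}" "{x. B.ord x = 4} = - ?S"
    unfolding ord_cases by auto
  moreover have "{x. B.ord x = d} = {}" if "d \<notin> {1, 2, 4}" for d
    using that unfolding ord_cases by auto
  moreover have "card (?S - {bits_one}) = 31"
    using card_square_one[of t] by (subst card_Diff_singleton) auto
  moreover have "card (- ?S) = 32"
    using card_square_one[of t] order_bits_group[of t]
    by (subst Compl_eq_Diff_UNIV, subst card_Diff_subset)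
      (simp_all add: Coset.order_def)
  ultimately show ?thesis
    by (simp add: order_list_def order_bits_group divisors_64)
qed

section \<open>Square roots of 1 in centralizers\<close>

definition num_commuting_square_one :: "('a, 'b) monoid_scheme \<Rightarrow> 'a \<Rightarrow> nat" where
  "num_commuting_square_one G x =
    card {y \<in> carrier G. y \<otimes>\<^bsub>G\<^esub> y = \<one>\<^bsub>G\<^esub> \<and> x \<otimes>\<^bsub>G\<^esub> y = y \<otimes>\<^bsub>G\<^esub> x}"

lemma num_commuting_square_one_iso:
  assumes "group G" "group H" "\<phi> \<in> iso G H" "x \<in> carrier G"
  shows "num_commuting_square_one H (\<phi> x) = num_commuting_square_one G x"
proof -
  interpret G: group G by fact
  have bij: "bij_betw \<phi> (carrier G) (carrier H)" and hom: "\<phi> \<in> hom G H"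
    using assms(3) by (simp_all add: iso_def)
  have one: "\<phi> \<one>\<^bsub>G\<^esub> = \<one>\<^bsub>H\<^esub>" using hom assms(1,2) by (rule hom_one)
  have eq: "u = v \<longleftrightarrow> \<phi> u = \<phi> v" if "u \<in> carrier G" "v \<in> carrier G" for u v
    using bij that by (auto simp: bij_betw_def inj_on_def)
  show ?thesis
    unfolding num_commuting_square_one_def
  proof (rule card_Collect_bij_betw[OF bij, symmetric])
    fix y assume y: "y \<in> carrier G"
    show "y \<otimes>\<^bsub>G\<^esub> y = \<one>\<^bsub>G\<^esub> \<and> x \<otimes>\<^bsub>G\<^esub> y = y \<otimes>\<^bsub>G\<^esub> x \<longleftrightarrow>
        \<phi> y \<otimes>\<^bsub>H\<^esub> \<phi> y = \<one>\<^bsub>H\<^esub> \<and> \<phi> x \<otimes>\<^bsub>H\<^esub> \<phi> y = \<phi> y \<otimes>\<^bsub>H\<^esub> \<phi> x"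
      using eq[of "y \<otimes>\<^bsub>G\<^esub> y" "\<one>\<^bsub>G\<^esub>"] eq[of "x \<otimes>\<^bsub>G\<^esub> y" "y \<otimes>\<^bsub>G\<^esub> x"] y assms(4) one
      by (simp add: hom_mult[OF hom])
  qed
qed

lemma num_commuting_bits_True: "num_commuting_square_one (bits_group True) (bits_gen F1) = 8"
proof -
  have "card {y. bits_mult True y y = bits_one \<and>
      bits_mult True (bits_gen F1) y = bits_mult True y (bits_gen F1)} = 8"
    by code_simp
  then show ?thesis by (simp add: num_commuting_square_one_def)
qed

text \<open>Settled by evaluation over all 64 elements of the model.\<close>

lemma num_commuting_bits_False:
  assumes "bits_mult False x x = bits_one"
  shows "num_commuting_square_one (bits_group False) x \<noteq> 8"
proof -
  have "\<forall>x. bits_mult False x x = bits_one \<longrightarrow>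
      card {y. bits_mult False y y = bits_one \<and> bits_mult False x y = bits_mult False y x} \<noteq> 8"
    by code_simp
  from this[rule_format, OF assms] show ?thesis by (simp add: num_commuting_square_one_def)
qed

lemma not_iso_bits_group: "\<not> bits_group False \<cong> bits_group True"
proof
  assume "bits_group False \<cong> bits_group True"
  \<comment> \<open>The isomorphism is reversed because the distinguished element \<open>f1\<close>
    belongs to the group with flag \<open>True\<close>, and its image has to be examined in the
    other one.\<close>
  then have "bits_group True \<cong> bits_group False"
    using group.iso_sym[OF group_bits_group] by blast
  then obtain \<phi> where \<phi>: "\<phi> \<in> iso (bits_group True) (bits_group False)"
    by (auto simp: is_iso_def)
  have "num_commuting_square_one (bits_group False) (\<phi> (bits_gen F1)) = 8"
    using num_commuting_square_one_iso[OF group_bits_group group_bits_group \<phi>, of "bits_gen F1"]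
      num_commuting_bits_True by simp
  moreover have "bits_mult False (\<phi> (bits_gen F1)) (\<phi> (bits_gen F1)) = bits_one"
    using iso_pow_eq_one_iff[OF group_bits_group group_bits_group \<phi>, of "bits_gen F1" 2]
    by (simp add: bits_pow2)
  ultimately show False using num_commuting_bits_False by blast
qed


section \<open>Controlled involutions\<close>

text \<open>This and the following variants replace carrier assumptions by equations between
  dimensions, which the simplifier can discharge without guessing intermediate sizes.\<close>

lemma assoc_mult_mat_dim:
  fixes A B C :: "'a::semiring_0 mat"
  shows "dim_col A = dim_row B \<Longrightarrow> dim_col B = dim_row C \<Longrightarrow> A * B * C = A * (B * C)"
  by (rule assoc_mult_mat[of _ "dim_row A" "dim_col A" _ "dim_col B" _ "dim_col C"]) auto

lemma mult_add_distrib_mat_dim: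
  fixes A B C :: "'a::semiring_0 mat"
  shows "dim_col A = dim_row B \<Longrightarrow> dim_row B = dim_row C \<Longrightarrow> dim_col B = dim_col C \<Longrightarrow>
    A * (B + C) = A * B + A * C"
  by (rule mult_add_distrib_mat[of _ "dim_row A" "dim_col A" _ "dim_col B"]) auto

lemma add_mult_distrib_mat_dim:
  fixes A B C :: "'a::semiring_0 mat"
  shows "dim_col A = dim_row C \<Longrightarrow> dim_row A = dim_row B \<Longrightarrow> dim_col A = dim_col B \<Longrightarrow>
    (A + B) * C = A * C + B * C"
  by (rule add_mult_distrib_mat[of _ "dim_row A" "dim_col A" _ _ "dim_col C"]) auto

lemma mult_smult_dim:
  fixes A B :: "complex mat"
  shows "dim_col A = dim_row B \<Longrightarrow> A * (c \<cdot>\<^sub>m B) = c \<cdot>\<^sub>m (A * B)"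
    "dim_col A = dim_row B \<Longrightarrow> (c \<cdot>\<^sub>m A) * B = c \<cdot>\<^sub>m (A * B)"
  by (rule mult_smult_distrib[of _ "dim_row A" "dim_col A" _ "dim_col B"]
      mult_smult_assoc_mat[of _ "dim_row A" "dim_col A" _ "dim_col B"]; auto)+

lemma add_zero_mat_dim:
  fixes A :: "'a::monoid_add mat"
  shows "dim_row A = n \<Longrightarrow> dim_col A = m \<Longrightarrow> A + 0\<^sub>m n m = A"
    "dim_row A = n \<Longrightarrow> dim_col A = m \<Longrightarrow> 0\<^sub>m n m + A = A"
  by (rule eq_matI; simp)+

lemmas mat_ring_simps = assoc_mult_mat_dim mult_add_distrib_mat_dim add_mult_distrib_mat_dim mult_smult_dim

section \<open>Kronecker products and adjoints\<close>

lemma kron_add_left: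
  fixes A B C :: "complex mat"
  shows "dim_row A = dim_row B \<Longrightarrow> dim_col A = dim_col B \<Longrightarrow> kron (A + B) C = kron A C + kron B C"
  by (rule eq_matI) (auto simp: index_kron div_mod_bounds algebra_simps)

lemma kron_add_right:
  fixes A B C :: "complex mat"
  shows "dim_row B = dim_row C \<Longrightarrow> dim_col B = dim_col C \<Longrightarrow> kron A (B + C) = kron A B + kron A C"
  by (rule eq_matI) (auto simp: index_kron div_mod_bounds algebra_simps)

lemma kron_smult:
  fixes A B :: "complex mat"
  shows "kron (c \<cdot>\<^sub>m A) B = c \<cdot>\<^sub>m kron A B" "kron A (c \<cdot>\<^sub>m B) = c \<cdot>\<^sub>m kron A B"
  by (rule eq_matI; auto simp: index_kron div_mod_bounds)+

lemma kron_mult_dim: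
  fixes A B C D :: "complex mat"
  assumes "dim_col A = dim_row C" "dim_col B = dim_row D"
  shows "kron A B * kron C D = kron (A * C) (B * D)"
  using assms by (intro kron_mult[of _ "dim_row A" "dim_col A" _ "dim_col C" _ "dim_row B" "dim_col B" _ "dim_col D"]) auto

lemma mat_adjoint_add:
  fixes A B :: "complex mat"
  shows "dim_row A = dim_row B \<Longrightarrow> dim_col A = dim_col B \<Longrightarrow>
    mat_adjoint (A + B) = mat_adjoint A + mat_adjoint B"
  by (rule eq_matI) (auto simp: index_mat_adjoint)

lemma mat_adjoint_smult: "mat_adjoint (c \<cdot>\<^sub>m A) = cnj c \<cdot>\<^sub>m mat_adjoint (A :: complex mat)"
  by (rule eq_matI) (auto simp: index_mat_adjoint)

lemma mat_adjoint_one: "mat_adjoint (1\<^sub>m n :: complex mat) = 1\<^sub>m n"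
  by (rule eq_matI) (auto simp: index_mat_adjoint)

lemma mat_adjoint_mult:
  fixes A B :: "complex mat"
  assumes "dim_col A = dim_row B"
  shows "mat_adjoint (A * B) = mat_adjoint B * mat_adjoint A"
  by (rule eq_matI) (use assms in \<open>auto simp: index_mat_adjoint scalar_prod_def mult.commute\<close>)

lemma mat_adjoint_involution:
  fixes U :: "complex mat"
  assumes "dim_row U = n" "dim_col U = n" "mat_adjoint U * U = 1\<^sub>m n" "U * U = 1\<^sub>m n"
  shows "mat_adjoint U = U"
proof -
  have "mat_adjoint U = mat_adjoint U * (U * U)" using assms by simp
  also have "\<dots> = (mat_adjoint U * U) * U" using assms(1,2) by (simp add: mat_ring_simps)
  finally show ?thesis using assms by simp
qed

text \<open>For an involution, these are the projections onto the eigenspaces of 1 and -1.\<close>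

definition plus_proj :: "complex mat \<Rightarrow> complex mat" where
  "plus_proj X = (1/2) \<cdot>\<^sub>m (1\<^sub>m (dim_row X) + X)"

definition minus_proj :: "complex mat \<Rightarrow> complex mat" where
  "minus_proj X = (1/2) \<cdot>\<^sub>m (1\<^sub>m (dim_row X) + (-1) \<cdot>\<^sub>m X)"

text \<open>The controlled gate. For involutions it is the sign (-1)^(a b) on the joint eigenspace
  where \<open>X\<close> is (-1)^a on the first factor and \<open>Y\<close> is (-1)^b on the second,
  hence a building block for bicharacters.\<close>

definition controlled :: "complex mat \<Rightarrow> complex mat \<Rightarrow> complex mat" where
  "controlled X Y = kron (plus_proj X) (1\<^sub>m (dim_row Y)) + kron (minus_proj X) Y"

lemma dim_proj [simp]:
  "dim_row (plus_proj X) = dim_row X" "dim_col (plus_proj X) = dim_col X"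
  "dim_row (minus_proj X) = dim_row X" "dim_col (minus_proj X) = dim_col X"
  by (simp_all add: plus_proj_def minus_proj_def)

lemma dim_controlled [simp]:
  "dim_row (controlled X Y) = dim_row X * dim_row Y"
  "dim_col (controlled X Y) = dim_col X * dim_col Y"
  by (simp_all add: controlled_def)

lemma proj_mult_involution:
  assumes "dim_row X = n" "dim_col X = n" "X * X = 1\<^sub>m n"
  shows "plus_proj X * X = plus_proj X" "minus_proj X * X = (-1) \<cdot>\<^sub>m minus_proj X"
  by (rule eq_matI; use assms in \<open>simp add: plus_proj_def minus_proj_def mat_ring_simps\<close>)+

lemma proj_mult:
  assumes "dim_row X = n" "dim_col X = n" "X * X = 1\<^sub>m n"
  shows "plus_proj X * plus_proj X = plus_proj X" "minus_proj X * minus_proj X = minus_proj X"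
    "plus_proj X * minus_proj X = 0\<^sub>m n n" "minus_proj X * plus_proj X = 0\<^sub>m n n"
  by (rule eq_matI; use assms in \<open>simp add: plus_proj_def minus_proj_def mat_ring_simps field_simps\<close>)+

lemma proj_intertwine:
  assumes "S * X = X' * S" "dim_row X = dim_col S" "dim_col X = dim_col S"
    "dim_row X' = dim_row S" "dim_col X' = dim_row S"
  shows "S * plus_proj X = plus_proj X' * S" "S * minus_proj X = minus_proj X' * S"
  using assms by (simp_all add: plus_proj_def minus_proj_def mat_ring_simps)

text \<open>Control and target are interchangeable: both expressions expand to half of 1 + X + Y - X
  Y, each matrix acting on its own tensor factor.\<close>

lemma controlled_alt:
  assumes "dim_row X = dim_col X" "dim_row Y = dim_col Y"
  shows "controlled X Y = kron (1\<^sub>m (dim_row X)) (plus_proj Y) + kron X (minus_proj Y)"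
  using assms
  by (intro eq_matI)
    (auto simp: controlled_def plus_proj_def minus_proj_def index_kron div_mod_bounds field_simps)

lemma zero_kron:
  "kron (0\<^sub>m n m) (B :: complex mat) = 0\<^sub>m (n * dim_row B) (m * dim_col B)"
  "kron (B :: complex mat) (0\<^sub>m n m) = 0\<^sub>m (dim_row B * n) (dim_col B * m)"
  by (rule eq_matI; auto simp: index_kron div_mod_bounds)+

text \<open>Multiplicativity in the target: the two projections of the involution \<open>X\<close>
  are orthogonal, so mixed terms vanish. The next lemma is the mirror image through
  \<open>controlled_alt\<close>.\<close>

lemma controlled_mult_right:
  assumes "dim_row X = n" "dim_col X = n" "X * X = 1\<^sub>m n"
    and "dim_row Y = m" "dim_col Y = m" "dim_row Y' = m" "dim_col Y' = m"
  shows "controlled X Y * controlled X Y' = controlled X (Y * Y')"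
  using assms
  by (simp add: controlled_def mat_ring_simps kron_mult_dim proj_mult zero_kron add_zero_mat_dim)

lemma controlled_mult_left:
  assumes "dim_row X = n" "dim_col X = n" "dim_row X' = n" "dim_col X' = n"
    and "dim_row Y = m" "dim_col Y = m" "Y * Y = 1\<^sub>m m"
  shows "controlled X Y * controlled X' Y = controlled (X * X') Y"
  using assms
  by (simp add: controlled_alt mat_ring_simps kron_mult_dim proj_mult zero_kron add_zero_mat_dim)

text \<open>Serves two purposes: naturality when \<open>S\<close> and \<open>T\<close> are
  morphisms, and the effect of conjugation when they are images of group elements.\<close>

lemma controlled_intertwine:
  assumes "S * X = X' * S" "dim_row X = dim_col S" "dim_col X = dim_col S"
    "dim_row X' = dim_row S" "dim_col X' = dim_row S"
    and "T * Y = Y' * T" "dim_row Y = dim_col T" "dim_col Y = dim_col T"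
    "dim_row Y' = dim_row T" "dim_col Y' = dim_row T"
  shows "kron S T * controlled X Y = controlled X' Y' * kron S T"
  using assms proj_intertwine[OF assms(1-5)]
  by (simp add: controlled_def mat_ring_simps kron_mult_dim)

lemma controlled_commute:
  assumes "dim_row X = n" "dim_col X = n" "dim_row X' = n" "dim_col X' = n" "X * X' = X' * X"
    and "dim_row Y = m" "dim_col Y = m" "dim_row Y' = m" "dim_col Y' = m" "Y * Y' = Y' * Y"
  shows "controlled X Y * controlled X' Y' = controlled X' Y' * controlled X Y"
proof -
  have "kron (plus_proj X) (1\<^sub>m m) * controlled X' Y' = controlled X' Y' * kron (plus_proj X) (1\<^sub>m m)"
    using proj_intertwine(1)[of X' X X] assms by (intro controlled_intertwine) auto
  moreover have "kron (minus_proj X) Y * controlled X' Y' = controlled X' Y' * kron (minus_proj X) Y"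
    using proj_intertwine(2)[of X' X X] assms by (intro controlled_intertwine) auto
  ultimately show ?thesis
    using assms by (simp add: controlled_def[of X Y] mat_ring_simps)
qed

lemma controlled_one:
  "dim_row Y = m \<Longrightarrow> dim_col Y = m \<Longrightarrow> controlled (1\<^sub>m n) Y = 1\<^sub>m (n * m)"
  "dim_row X = n \<Longrightarrow> dim_col X = n \<Longrightarrow> controlled X (1\<^sub>m m) = 1\<^sub>m (n * m)"
proof -
  have 1: "plus_proj (1\<^sub>m k) = 1\<^sub>m k" "minus_proj (1\<^sub>m k) = 0\<^sub>m k k" for k
    by (rule eq_matI; auto simp: plus_proj_def minus_proj_def)+
  show "dim_row Y = m \<Longrightarrow> dim_col Y = m \<Longrightarrow> controlled (1\<^sub>m n) Y = 1\<^sub>m (n * m)"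
    by (simp add: controlled_def 1 kron_one zero_kron)
  show "dim_row X = n \<Longrightarrow> dim_col X = n \<Longrightarrow> controlled X (1\<^sub>m m) = 1\<^sub>m (n * m)"
    by (simp add: controlled_alt 1 kron_one zero_kron)
qed

lemma mat_adjoint_controlled:
  assumes "mat_adjoint X = X" "mat_adjoint Y = Y"
  shows "mat_adjoint (controlled X Y) = controlled X Y"
proof -
  have d: "dim_col X = dim_row X" "dim_col Y = dim_row Y"
    using assms dim_mat_adjoint by metis+
  show ?thesis
    using d by (simp add: controlled_def plus_proj_def minus_proj_def mat_adjoint_add mat_adjoint_smult
        mat_adjoint_kron mat_adjoint_one assms)
qed

text \<open>Padding with identities places the gate on two of three tensor legs: legs 1 and 3, then
  2 and 3, then 1 and 2.\<close>

lemma controlled_kron: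
  assumes "dim_row X = n" "dim_col X = n" "dim_row Y = m" "dim_col Y = m"
  shows "controlled (kron X (1\<^sub>m k)) Y = controlled X (kron (1\<^sub>m k) Y)"
    and "controlled (kron (1\<^sub>m k) X) Y = kron (1\<^sub>m k) (controlled X Y)"
    and "controlled X (kron Y (1\<^sub>m k)) = kron (controlled X Y) (1\<^sub>m k)"
proof -
  have l: "plus_proj (kron X (1\<^sub>m k)) = kron (plus_proj X) (1\<^sub>m k)"
    "minus_proj (kron X (1\<^sub>m k)) = kron (minus_proj X) (1\<^sub>m k)"
    using assms by (simp_all add: plus_proj_def minus_proj_def kron_add_left kron_smult kron_one)
  have r: "plus_proj (kron (1\<^sub>m k) X) = kron (1\<^sub>m k) (plus_proj X)"
    "minus_proj (kron (1\<^sub>m k) X) = kron (1\<^sub>m k) (minus_proj X)"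
    using assms by (simp_all add: plus_proj_def minus_proj_def kron_add_right kron_smult kron_one)
  show "controlled (kron X (1\<^sub>m k)) Y = controlled X (kron (1\<^sub>m k) Y)"
    using assms by (simp add: controlled_def l kron_assoc kron_one)
  show "controlled (kron (1\<^sub>m k) X) Y = kron (1\<^sub>m k) (controlled X Y)"
    using assms by (simp add: controlled_def r kron_assoc kron_add_right)
  show "controlled X (kron Y (1\<^sub>m k)) = kron (controlled X Y) (1\<^sub>m k)"
    using assms by (simp add: controlled_def kron_assoc kron_add_left kron_one)
qed


section \<open>Square roots of involutions\<close>

text \<open>With \<open>s = \<plusminus>\<i>\<close> this is 1 on the eigenspace of 1 and \<open>s\<close> on the eigenspace of -1.\<close>

definition phase :: "complex \<Rightarrow> complex mat \<Rightarrow> complex mat" where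
  "phase s X = ((1 + s) / 2) \<cdot>\<^sub>m 1\<^sub>m (dim_row X) + ((1 - s) / 2) \<cdot>\<^sub>m X"

lemma dim_phase [simp]: "dim_row (phase s X) = dim_row X" "dim_col (phase s X) = dim_col X"
  by (simp_all add: phase_def)

lemma phase_one: "phase s (1\<^sub>m n) = 1\<^sub>m n"
  by (rule eq_matI) (auto simp: phase_def field_simps)

lemma phase_intertwine:
  assumes "S * X = X' * S" "dim_row X = dim_col S" "dim_col X = dim_col S"
    "dim_row X' = dim_row S" "dim_col X' = dim_row S"
  shows "S * phase s X = phase s X' * S"
  using assms by (simp add: phase_def mat_ring_simps)

text \<open>Eigenvalues multiply on each eigenspace. For \<open>s * s = -1\<close> this and
  \<open>phase_pm_one\<close> make \<open>phase s X\<close> a square root of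
  \<open>X\<close>.\<close>

lemma phase_mult:
  assumes "dim_row X = n" "dim_col X = n" "X * X = 1\<^sub>m n"
  shows "phase s X * phase r X = phase (s * r) X"
  by (rule eq_matI; use assms in \<open>simp add: phase_def mat_ring_simps field_simps\<close>)

lemma phase_pm_one:
  assumes "dim_row X = n" "dim_col X = n"
  shows "phase 1 X = 1\<^sub>m n" "phase (-1) X = X"
  by (rule eq_matI; use assms in \<open>simp add: phase_def\<close>)+

lemma mat_adjoint_phase:
  assumes "mat_adjoint X = X" "cnj s = - s"
  shows "mat_adjoint (phase s X) = phase (- s) X"
proof -
  have "dim_col X = dim_row X" using assms(1) dim_mat_adjoint by metis
  then show ?thesis
    by (simp add: phase_def mat_adjoint_add mat_adjoint_smult mat_adjoint_one assms)
qed

lemma proj_phase: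
  assumes "dim_row X = n" "dim_col X = n" "X * X = 1\<^sub>m n"
  shows "plus_proj X * phase s X = plus_proj X" "minus_proj X * phase s X = s \<cdot>\<^sub>m minus_proj X"
  by (rule eq_matI; use assms in \<open>simp add: phase_def mat_ring_simps proj_mult_involution field_simps\<close>)+

text \<open>On the joint eigenspace with signs (-1)^a and (-1)^b the claim is (-1)^(a b) s^a s^b =
  s^(a + b mod 2), which is where s^2 = -1 is used. So \<open>controlled X Y\<close> measures
  exactly how far the phase is from being group-like.\<close>

lemma controlled_phase:
  assumes X: "dim_row X = n" "dim_col X = n" "X * X = 1\<^sub>m n"
    and Y: "dim_row Y = m" "dim_col Y = m" "Y * Y = 1\<^sub>m m"
    and s: "s * s = -1"
  shows "controlled X Y * kron (phase s X) (phase s Y) = phase s (kron X Y)"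
proof -
  have "Y * phase s Y = ((1 + s) / 2) \<cdot>\<^sub>m Y + ((1 - s) / 2) \<cdot>\<^sub>m 1\<^sub>m m"
    using Y by (simp add: phase_def mat_ring_simps)
  then have "controlled X Y * kron (phase s X) (phase s Y) = kron (plus_proj X) (phase s Y) +
      kron (s \<cdot>\<^sub>m minus_proj X) (((1 + s) / 2) \<cdot>\<^sub>m Y + ((1 - s) / 2) \<cdot>\<^sub>m 1\<^sub>m m)"
    using X Y by (simp add: controlled_def mat_ring_simps kron_mult_dim proj_phase)
  also have "\<dots> = phase s (kron X Y)"
  proof (rule eq_matI)
    fix i j assume "i < dim_row (phase s (kron X Y))" "j < dim_col (phase s (kron X Y))"
    then have ij: "i < n * m" "j < n * m" using X Y by simp_all
    define x y d e where "x = X $$ (i div m, j div m)" and "y = Y $$ (i mod m, j mod m)"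
      and "d = (1\<^sub>m n :: complex mat) $$ (i div m, j div m)"
      and "e = (1\<^sub>m m :: complex mat) $$ (i mod m, j mod m)"
    \<comment> \<open>Both rules come from \<open>s * s = -1\<close> and make the entrywise identity
      linear in \<open>s\<close>. The entries \<open>d\<close> and \<open>e\<close> of the identity
      matrices stay symbolic.\<close>
    have "s * (1 + s) = - (1 - s)" "s * (1 - s) = 1 + s" using s by (simp_all add: algebra_simps)
    have "(1/2) * (d + x) * (((1 + s) / 2) * e + ((1 - s) / 2) * y)
        + s * ((1/2) * (d - x)) * (((1 + s) / 2) * y + ((1 - s) / 2) * e)
      = (1/4) * ((d + x) * ((1 + s) * e + (1 - s) * y) + (d - x) * ((s * (1 + s)) * y + (s * (1 - s)) * e))"
      by (simp add: field_simps)
    also have "\<dots> = (1/4) * ((d + x) * ((1 + s) * e + (1 - s) * y) + (d - x) * (- (1 - s) * y + (1 + s) * e))"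
      by (simp only: \<open>s * (1 + s) = - (1 - s)\<close> \<open>s * (1 - s) = 1 + s\<close>)
    also have "\<dots> = ((1 + s) / 2) * (d * e) + ((1 - s) / 2) * (x * y)"
      by (simp add: field_simps)
    finally have "(kron (plus_proj X) (phase s Y) + kron (s \<cdot>\<^sub>m minus_proj X)
        (((1 + s) / 2) \<cdot>\<^sub>m Y + ((1 - s) / 2) \<cdot>\<^sub>m 1\<^sub>m m)) $$ (i, j)
      = ((1 + s) / 2) * (d * e) + ((1 - s) / 2) * (x * y)"
      using ij X Y
      by (simp add: index_kron div_mod_bounds plus_proj_def minus_proj_def phase_def
          x_def y_def d_def e_def del: index_one_mat(1))
    also have "d * e = kron (1\<^sub>m n) (1\<^sub>m m) $$ (i, j)"
      using ij by (simp add: index_kron d_def e_def del: index_one_mat(1))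
    finally show "(kron (plus_proj X) (phase s Y) + kron (s \<cdot>\<^sub>m minus_proj X)
        (((1 + s) / 2) \<cdot>\<^sub>m Y + ((1 - s) / 2) \<cdot>\<^sub>m 1\<^sub>m m)) $$ (i, j) = phase s (kron X Y) $$ (i, j)"
      using ij X Y by (simp add: kron_one phase_def index_kron[of i X Y j] x_def y_def del: index_one_mat(1))
  qed (use X Y in simp_all)
  finally show ?thesis .
qed


section \<open>Unitary groups\<close>

lemma unitary_groupD:
  assumes "U \<in> carrier (unitary_group n)"
  shows "dim_row U = n" "dim_col U = n" "mat_adjoint U * U = 1\<^sub>m n" "U * mat_adjoint U = 1\<^sub>m n"
  using assms by (auto simp: unitary_group_def)

lemma unitary_group_mult: "x \<otimes>\<^bsub>unitary_group n\<^esub> y = x * y"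
  by (simp add: unitary_group_def)

lemma unitary_group_one: "\<one>\<^bsub>unitary_group n\<^esub> = 1\<^sub>m n"
  by (simp add: unitary_group_def)

lemma unitary_groupI:
  "dim_row U = n \<Longrightarrow> dim_col U = n \<Longrightarrow> mat_adjoint U * U = 1\<^sub>m n \<Longrightarrow> U * mat_adjoint U = 1\<^sub>m n \<Longrightarrow>
    U \<in> carrier (unitary_group n)"
  by (auto simp: unitary_group_def)

lemma mat_adjoint_adjoint: "mat_adjoint (mat_adjoint A) = (A :: complex mat)"
  by (rule eq_matI) (auto simp: index_mat_adjoint)

lemma unitary_group_mult_closed:
  assumes "U \<in> carrier (unitary_group n)" "V \<in> carrier (unitary_group n)"
  shows "U * V \<in> carrier (unitary_group n)"
proof (rule unitary_groupI)
  note U = unitary_groupD[OF assms(1)] and V = unitary_groupD[OF assms(2)]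
  have "mat_adjoint (U * V) * (U * V) = mat_adjoint V * ((mat_adjoint U * U) * V)"
    using U(1,2) V(1,2) by (simp add: mat_adjoint_mult mat_ring_simps)
  then show "mat_adjoint (U * V) * (U * V) = 1\<^sub>m n" using U V by simp
  have "(U * V) * mat_adjoint (U * V) = U * ((V * mat_adjoint V) * mat_adjoint U)"
    using U(1,2) V(1,2) by (simp add: mat_adjoint_mult mat_ring_simps)
  then show "(U * V) * mat_adjoint (U * V) = 1\<^sub>m n" using U V by simp
qed (use assms[THEN unitary_groupD(1)] assms[THEN unitary_groupD(2)] in simp_all)

lemma group_unitary_group: "group (unitary_group n)"
proof (rule groupI)
  fix U V W assume c: "U \<in> carrier (unitary_group n)" "V \<in> carrier (unitary_group n)"
    "W \<in> carrier (unitary_group n)"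
  show "U \<otimes>\<^bsub>unitary_group n\<^esub> V \<in> carrier (unitary_group n)"
    using c by (simp add: unitary_group_mult unitary_group_mult_closed)
  show "U \<otimes>\<^bsub>unitary_group n\<^esub> V \<otimes>\<^bsub>unitary_group n\<^esub> W =
      U \<otimes>\<^bsub>unitary_group n\<^esub> (V \<otimes>\<^bsub>unitary_group n\<^esub> W)"
    using c[THEN unitary_groupD(1)] c[THEN unitary_groupD(2)]
    by (simp add: unitary_group_mult mat_ring_simps)
next
  show "\<one>\<^bsub>unitary_group n\<^esub> \<in> carrier (unitary_group n)"
    by (rule unitary_groupI) (simp_all add: unitary_group_one mat_adjoint_one)
next
  fix U assume "U \<in> carrier (unitary_group n)"
  note U = unitary_groupD[OF this]
  show "\<one>\<^bsub>unitary_group n\<^esub> \<otimes>\<^bsub>unitary_group n\<^esub> U = U"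
    using U by (simp add: unitary_group_mult unitary_group_one)
  have "mat_adjoint U \<in> carrier (unitary_group n)"
    using U by (intro unitary_groupI) (simp_all add: mat_adjoint_adjoint)
  then show "\<exists>V\<in>carrier (unitary_group n). V \<otimes>\<^bsub>unitary_group n\<^esub> U = \<one>\<^bsub>unitary_group n\<^esub>"
    using U by (auto simp: unitary_group_mult unitary_group_one)
qed


section \<open>Unitary representations on generators\<close>

lemma commute_left:
  fixes A B C :: "complex mat"
  assumes "A * B = B * A" "dim_col A = dim_row A" "dim_row B = dim_row A" "dim_col B = dim_row A"
    "dim_row C = dim_row A"
  shows "A * (B * C) = B * (A * C)"
  using assms by (metis assoc_mult_mat_dim)

lemma unitary_group_phase:
  assumes "X \<in> carrier (unitary_group n)" "X * X = 1\<^sub>m n" "s * s = -1" "cnj s = - s"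
  shows "phase s X \<in> carrier (unitary_group n)"
proof -
  note X = unitary_groupD[OF assms(1)]
  have "mat_adjoint (phase s X) = phase (- s) X"
    using X assms by (intro mat_adjoint_phase mat_adjoint_involution)
  then show ?thesis
    using X assms(2,3) by (intro unitary_groupI) (simp_all add: phase_mult phase_pm_one)
qed

text \<open>A unitary representation of \<open>Gp t\<close>, stored by the images of the generators;
  \<open>rep_of\<close> and \<open>on_gens\<close> translate to and from objects of
  \<open>Rep\<close>.\<close>

locale gen_rep =
  fixes t :: bool and n :: nat and r :: "gen \<Rightarrow> complex mat"
  assumes unitary: "r x \<in> carrier (unitary_group n)"
    and rels: "satisfies_rels t (unitary_group n) r"
begin

lemma dim [simp]: "dim_row (r x) = n" "dim_col (r x) = n"
  using unitary_groupD[OF unitary] by auto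

lemma rel:
  "x \<noteq> F2 \<Longrightarrow> r x * r x = 1\<^sub>m n"
  "r F2 * r F2 = (if t then r F5 else 1\<^sub>m n)"
  "r F2 * r F1 = r F1 * (r F2 * r F5)"
  "r F3 * r F1 = r F1 * (r F3 * r F6)"
  "r F3 * r F2 = r F2 * (r F3 * r F5)"
  "r F4 * r F1 = r F1 * (r F4 * r F5)"
  "r F4 * r F2 = r F2 * r F4"
  "r F4 * r F3 = r F3 * r F4"
  "r F5 * r x = r x * r F5"
  "r F6 * r x = r x * r F6"
proof -
  note * = rels[unfolded satisfies_rels_def unitary_group_mult unitary_group_one]
  have "\<forall>x. x \<noteq> F2 \<longrightarrow> r x * r x = 1\<^sub>m n" using * by (elim conjE)
  then show "x \<noteq> F2 \<Longrightarrow> r x * r x = 1\<^sub>m n" by blast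
  have "\<forall>x. r F5 * r x = r x * r F5" using * by (elim conjE)
  then show "r F5 * r x = r x * r F5" by blast
  have "\<forall>x. r F6 * r x = r x * r F6" using * by (elim conjE)
  then show "r F6 * r x = r x * r F6" by blast
  show "r F2 * r F2 = (if t then r F5 else 1\<^sub>m n)"
    "r F2 * r F1 = r F1 * (r F2 * r F5)" "r F3 * r F1 = r F1 * (r F3 * r F6)"
    "r F3 * r F2 = r F2 * (r F3 * r F5)" "r F4 * r F1 = r F1 * (r F4 * r F5)"
    "r F4 * r F2 = r F2 * r F4" "r F4 * r F3 = r F3 * r F4"
    using * by - (elim conjE, assumption)+
qed

lemma self_adjoint: "x \<noteq> F2 \<Longrightarrow> mat_adjoint (r x) = r x"
  using unitary_groupD[OF unitary, of x] rel(1) by (intro mat_adjoint_involution) auto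

lemma abelian:
  assumes "x \<in> {F3, F4, F5, F6}" "y \<in> {F3, F4, F5, F6}"
  shows "r x * r y = r y * r x"
  using assms rel(8) rel(9)[of x] rel(10)[of x] rel(9)[of y] rel(10)[of y] by auto

end

text \<open>\<open>phase s (r F5)\<close> is the image of the central unitary \<open>Z\<close> for
  \<open>s = \<i>\<close> and of its inverse for \<open>s = - \<i>\<close>.\<close>

definition twist_gen :: "complex \<Rightarrow> (gen \<Rightarrow> complex mat) \<Rightarrow> gen \<Rightarrow> complex mat" where
  "twist_gen s r = r(F2 := r F2 * phase s (r F5))"

context gen_rep
begin

lemma phase_commute: "phase s (r F5) * r x = r x * phase s (r F5)"
  by (rule phase_intertwine[symmetric]) (simp_all add: rel(9))

text \<open>The phase \<open>z\<close> commutes with all generators and squares to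
  \<open>r F5\<close>, so the square of \<open>r F2\<close> is multiplied by \<open>r F5\<close>,
  which flips the flag in either direction. Every other relation contains \<open>F2\<close> equally
  often on both sides and survives.\<close>

lemma twist_gen_rep:
  assumes s: "s * s = -1" "cnj s = - s"
  shows "gen_rep (\<not> t) n (twist_gen s r)"
proof
  have Z: "phase s (r F5) \<in> carrier (unitary_group n)"
    using unitary rel(1)[of F5] s by (intro unitary_group_phase) auto
  show "twist_gen s r x \<in> carrier (unitary_group n)" for x
    using unitary Z by (simp add: twist_gen_def unitary_group_mult_closed)
  define z where "z = phase s (r F5)"
  have dz [simp]: "dim_row z = n" "dim_col z = n" by (simp_all add: z_def)
  have zc: "z * r x = r x * z" for x
    by (simp add: z_def phase_commute)
  have zl: "z * (r x * A) = r x * (z * A)" if "dim_row A = n" for x A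
    using that zc by (intro commute_left) auto
  have z2: "z * z = r F5"
    using rel(1)[of F5] s by (simp add: z_def phase_mult phase_pm_one)
  have "r F2 * z * (r F2 * z) = (r F2 * r F2) * (z * z)"
    by (simp add: assoc_mult_mat_dim zl)
  also have "\<dots> = (if \<not> t then r F5 else 1\<^sub>m n)"
    using rel(1)[of F5] by (simp add: rel(2) z2)
  finally have sq: "r F2 * z * (r F2 * z) = (if \<not> t then r F5 else 1\<^sub>m n)" .
  have r21: "r F2 * z * r F1 = r F1 * (r F2 * z * r F5)"
  proof -
    have "r F2 * z * r F1 = (r F2 * r F1) * z" by (simp add: assoc_mult_mat_dim zc)
    then show ?thesis by (simp add: assoc_mult_mat_dim rel(3) zc)
  qed
  have r32: "r F3 * (r F2 * z) = r F2 * z * (r F3 * r F5)"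
  proof -
    have "r F3 * (r F2 * z) = (r F3 * r F2) * z" by (simp add: assoc_mult_mat_dim)
    then show ?thesis by (simp add: assoc_mult_mat_dim rel(5) zl zc)
  qed
  have c: "r x * (r F2 * z) = r F2 * z * r x" if "r x * r F2 = r F2 * r x" for x
  proof -
    have "r x * (r F2 * z) = (r x * r F2) * z" by (simp add: assoc_mult_mat_dim)
    then show ?thesis by (simp add: assoc_mult_mat_dim that zc)
  qed
  show "satisfies_rels (\<not> t) (unitary_group n) (twist_gen s r)"
    unfolding satisfies_rels_def unitary_group_mult unitary_group_one
    by (intro conjI allI impI)
      (simp_all add: twist_gen_def z_def[symmetric] sq r21 r32 c rel(1,7,8) rel(4,6) rel(9,10))
qed

text \<open>The twist leaves \<open>r F5\<close> alone, so the second twist multiplies by a phase of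
  the same matrix, and the two phases combine to \<open>phase 1\<close>.\<close>

lemma twist_gen_inverse:
  assumes "s * s = -1"
  shows "twist_gen (- s) (twist_gen s r) = r"
proof -
  have "r F2 * phase s (r F5) * phase (- s) (r F5) = r F2"
    using rel(1)[of F5] assms by (simp add: assoc_mult_mat_dim phase_mult phase_pm_one)
  then show ?thesis by (simp add: twist_gen_def fun_eq_iff)
qed

end

lemma twist_gen_intertwine:
  assumes "gen_rep t n r" "gen_rep t m q" "dim_row T = m" "dim_col T = n"
    and T: "\<And>x. T * r x = q x * T"
  shows "T * twist_gen s r x = twist_gen s q x * T"
proof -
  interpret r: gen_rep t n r by fact
  interpret q: gen_rep t m q by fact
  have Z: "T * phase s (r F5) = phase s (q F5) * T"
    using assms by (intro phase_intertwine) auto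
  have "T * (r F2 * phase s (r F5)) = (T * r F2) * phase s (r F5)"
    using assms(3,4) by (simp add: assoc_mult_mat_dim)
  also have "\<dots> = q F2 * (T * phase s (r F5))"
    using assms(3,4) by (simp add: T assoc_mult_mat_dim)
  also have "\<dots> = q F2 * phase s (q F5) * T"
    using assms(3,4) by (simp add: Z assoc_mult_mat_dim)
  finally show ?thesis using T by (simp add: twist_gen_def)
qed


section \<open>The tensor structure of the twist\<close>

text \<open>
  The bicharacter \<open>(-1) ^ (\<chi>\<^sub>5 \<psi>\<^sub>3 + \<chi>\<^sub>4 \<psi>\<^sub>6)\<close> on the dual of the normal elementary abelian subgroup
  generated by \<open>f\<^sub>3, f\<^sub>4, f\<^sub>5, f\<^sub>6\<close>. Its antisymmetrization is invariant under conjugation and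
  nondegenerate. Conjugation by \<open>f\<^sub>1\<close> fixes the bicharacter itself, while \<open>f\<^sub>2\<close> multiplies it by
  \<open>(-1) ^ (\<chi>\<^sub>5 \<psi>\<^sub>5)\<close>, the coboundary of the phase used in the twist.
\<close>

definition bichar :: "(gen \<Rightarrow> complex mat) \<Rightarrow> (gen \<Rightarrow> complex mat) \<Rightarrow> complex mat" where
  "bichar r q = controlled (r F5) (q F3) * controlled (r F4) (q F6)"

locale two_gen_reps = r: gen_rep t n r + q: gen_rep t m q for t n r m q
begin

lemma controlled_comm:
  assumes "{x, x', y, y'} \<subseteq> {F3, F4, F5, F6}"
  shows "controlled (r x) (q y) * controlled (r x') (q y') =
    controlled (r x') (q y') * controlled (r x) (q y)"
  using assms r.abelian q.abelian by (intro controlled_commute[where n = n and m = m]) auto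

lemma dim_bichar [simp]: "dim_row (bichar r q) = n * m" "dim_col (bichar r q) = n * m"
  by (simp_all add: bichar_def)

lemma controlled_square:
  assumes "x \<noteq> F2" "y \<noteq> F2"
  shows "controlled (r x) (q y) * controlled (r x) (q y) = 1\<^sub>m (n * m)"
  using assms r.rel(1)[of x] q.rel(1)[of y]
  by (subst controlled_mult_right[of _ n _ m]) (simp_all add: controlled_one)

text \<open>The two factors are commuting self-adjoint involutions, hence so is their
  product.\<close>

lemma bichar_unitary:
  "mat_adjoint (bichar r q) * bichar r q = 1\<^sub>m (n * m)"
  "bichar r q * mat_adjoint (bichar r q) = 1\<^sub>m (n * m)"
proof -
  let ?A = "controlled (r F5) (q F3)" and ?B = "controlled (r F4) (q F6)"
  have comm: "?B * ?A = ?A * ?B" by (rule controlled_comm) simp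
  have adj: "mat_adjoint (bichar r q) = bichar r q"
    using comm by (simp add: bichar_def mat_adjoint_mult mat_adjoint_controlled r.self_adjoint q.self_adjoint)
  have "?A * ?B * (?A * ?B) = ?A * ((?B * ?A) * ?B)" by (simp add: assoc_mult_mat_dim)
  also have "\<dots> = ?A * ?A * (?B * ?B)" unfolding comm by (simp add: assoc_mult_mat_dim)
  also have "\<dots> = 1\<^sub>m (n * m)" by (simp add: controlled_square)
  finally have "bichar r q * bichar r q = 1\<^sub>m (n * m)" by (simp add: bichar_def)
  then show "mat_adjoint (bichar r q) * bichar r q = 1\<^sub>m (n * m)"
    "bichar r q * mat_adjoint (bichar r q) = 1\<^sub>m (n * m)"
    by (simp_all add: adj)
qed

lemma bichar_conj_abelian:
  assumes "x \<in> {F3, F4, F5, F6}"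
  shows "bichar r q * kron (r x) (q x) = kron (r x) (q x) * bichar r q"
proof -
  let ?A = "controlled (r F5) (q F3)" and ?B = "controlled (r F4) (q F6)" and ?K = "kron (r x) (q x)"
  have A: "?K * ?A = ?A * ?K" and B: "?K * ?B = ?B * ?K"
    using assms r.abelian[OF assms] q.abelian[OF assms]
    by (intro controlled_intertwine; simp)+
  have "?A * ?B * ?K = ?A * (?K * ?B)" by (simp add: assoc_mult_mat_dim B)
  also have "\<dots> = (?A * ?K) * ?B" by (simp add: assoc_mult_mat_dim)
  also have "\<dots> = ?K * (?A * ?B)" by (simp add: assoc_mult_mat_dim flip: A)
  finally show ?thesis by (simp add: bichar_def)
qed

text \<open>Moving \<open>f1\<close> across turns \<open>f3\<close> into \<open>f3 f6\<close> and
  \<open>f4\<close> into \<open>f4 f5\<close>. Each of the two factors thereby picks up the same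
  involution \<open>?C\<close>, and the two copies cancel; this is why the bicharacter needs both
  factors.\<close>

lemma bichar_conj_F1: "bichar r q * kron (r F1) (q F1) = kron (r F1) (q F1) * bichar r q"
proof -
  let ?A = "controlled (r F5) (q F3)" and ?B = "controlled (r F4) (q F6)" and ?K = "kron (r F1) (q F1)"
  let ?C = "controlled (r F5) (q F6)"
  have A: "?K * controlled (r F5) (q F3 * q F6) = ?A * ?K"
    by (rule controlled_intertwine) (simp_all add: q.rel(4) r.rel(9))
  have "?K * controlled (r F4 * r F5) (q F6) = ?B * ?K"
    by (rule controlled_intertwine) (simp_all add: r.rel(6) q.rel(10))
  then have B: "?K * controlled (r F5 * r F4) (q F6) = ?B * ?K"
    by (simp add: r.rel(9))
  have AC: "controlled (r F5) (q F3 * q F6) = ?A * ?C"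
    using r.rel(1)[of F5] by (simp add: controlled_mult_right[of _ n _ m])
  have CB: "controlled (r F5 * r F4) (q F6) = ?C * ?B"
    using q.rel(1)[of F6] by (simp add: controlled_mult_left[of _ n _ _ m])
  have "?A * ?B * ?K = ?A * (?K * (?C * ?B))" by (simp add: assoc_mult_mat_dim flip: B CB)
  also have "\<dots> = (?A * ?K) * (?C * ?B)" by (simp add: assoc_mult_mat_dim)
  also have "\<dots> = ?K * (?A * ((?C * ?C) * ?B))" by (simp add: assoc_mult_mat_dim AC flip: A)
  also have "\<dots> = ?K * (?A * ?B)" by (simp add: controlled_square)
  finally show ?thesis by (simp add: bichar_def)
qed

text \<open>Moving \<open>f2\<close> across turns \<open>f3\<close> into \<open>f3 f5\<close> and
  fixes \<open>f4\<close>, \<open>f5\<close> and \<open>f6\<close>, so only the first factor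
  changes, by \<open>?C\<close>. By \<open>controlled_phase\<close> this is what turns the product
  of the two phases into the phase of the tensor product.\<close>

lemma bichar_conj_F2:
  assumes s: "s * s = -1"
  shows "bichar r q * kron (r F2 * phase s (r F5)) (q F2 * phase s (q F5)) =
    kron (r F2) (q F2) * phase s (kron (r F5) (q F5)) * bichar r q"
proof -
  let ?A = "controlled (r F5) (q F3)" and ?B = "controlled (r F4) (q F6)" and ?K = "kron (r F2) (q F2)"
  let ?C = "controlled (r F5) (q F5)" and ?Z = "kron (phase s (r F5)) (phase s (q F5))"
  have "?K * controlled (r F5) (q F3 * q F5) = ?A * ?K"
    by (rule controlled_intertwine) (simp_all add: q.rel(5) r.rel(9))
  then have A: "?K * controlled (r F5) (q F5 * q F3) = ?A * ?K"
    by (simp add: q.rel(9))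
  have B: "?K * ?B = ?B * ?K"
    by (rule controlled_intertwine) (simp_all add: r.rel(7) q.rel(10))
  have CA: "controlled (r F5) (q F5 * q F3) = ?C * ?A"
    using r.rel(1)[of F5] by (simp add: controlled_mult_right[of _ n _ m])
  have ZA: "?Z * ?A = ?A * ?Z" and ZB: "?Z * ?B = ?B * ?Z"
    by (intro controlled_intertwine; simp add: r.phase_commute q.phase_commute)+
  have CZ: "?C * ?Z = phase s (kron (r F5) (q F5))"
    using r.rel(1)[of F5] q.rel(1)[of F5] s by (simp add: controlled_phase)
  have "kron (r F2 * phase s (r F5)) (q F2 * phase s (q F5)) = ?K * ?Z"
    by (simp add: kron_mult_dim)
  then have "?A * ?B * kron (r F2 * phase s (r F5)) (q F2 * phase s (q F5)) = ?A * ((?B * ?K) * ?Z)"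
    by (simp add: assoc_mult_mat_dim)
  also have "\<dots> = (?A * ?K) * (?B * ?Z)" by (simp add: assoc_mult_mat_dim flip: B)
  also have "\<dots> = ?K * (?C * ((?A * ?Z) * ?B))" by (simp add: assoc_mult_mat_dim CA flip: A ZB)
  also have "\<dots> = ?K * ((?C * ?Z) * (?A * ?B))" by (simp add: assoc_mult_mat_dim flip: ZA)
  finally show ?thesis by (simp add: CZ bichar_def assoc_mult_mat_dim)
qed

lemma bichar_intertwine:
  assumes "s * s = -1"
  shows "bichar r q * kron (twist_gen s r x) (twist_gen s q x) =
    twist_gen s (\<lambda>x. kron (r x) (q x)) x * bichar r q"
  using bichar_conj_abelian[of x] bichar_conj_F1 bichar_conj_F2[OF assms]
  by (cases x) (simp_all add: twist_gen_def)

end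

lemma bichar_natural:
  assumes "two_gen_reps t n r m q" "two_gen_reps t n' r' m' q'"
    and "dim_row S = n'" "dim_col S = n" "\<And>x. S * r x = r' x * S"
    and "dim_row T = m'" "dim_col T = m" "\<And>x. T * q x = q' x * T"
  shows "bichar r' q' * kron S T = kron S T * bichar r q"
proof -
  interpret a: two_gen_reps t n r m q by fact
  interpret b: two_gen_reps t n' r' m' q' by fact
  have c: "kron S T * controlled (r x) (q y) = controlled (r' x) (q' y) * kron S T" for x y
    using assms(3-) by (intro controlled_intertwine) auto
  have "bichar r' q' * kron S T =
      controlled (r' F5) (q' F3) * (controlled (r' F4) (q' F6) * kron S T)"
    using assms(3-) by (simp add: bichar_def assoc_mult_mat_dim)
  also have "\<dots> = controlled (r' F5) (q' F3) * (kron S T * controlled (r F4) (q F6))"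
    by (simp only: c)
  also have "\<dots> = (controlled (r' F5) (q' F3) * kron S T) * controlled (r F4) (q F6)"
    using assms(3,4,6,7) by (simp add: assoc_mult_mat_dim)
  also have "\<dots> = kron S T * bichar r q"
    unfolding c[symmetric] using assms(3,4,6,7) by (simp add: bichar_def assoc_mult_mat_dim)
  finally show ?thesis .
qed

text \<open>Bimultiplicativity splits both sides into the same six gates on legs 12, 13 and 23;
  commutation makes their order irrelevant.\<close>

lemma bichar_cocycle:
  assumes "gen_rep t n r" "gen_rep t m q" "gen_rep t k p"
  shows "bichar (\<lambda>x. kron (r x) (q x)) p * kron (bichar r q) (1\<^sub>m k) =
    bichar r (\<lambda>x. kron (q x) (p x)) * kron (1\<^sub>m n) (bichar q p)"
proof -
  interpret r: gen_rep t n r by fact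
  interpret q: gen_rep t m q by fact
  interpret p: gen_rep t k p by fact
  \<comment> \<open>Leg notation: the digits name the two of three tensor factors on which the gate
    acts.\<close>
  define c12 where "c12 x y = controlled (r x) (kron (q y) (1\<^sub>m k))" for x y
  define c13 where "c13 x y = controlled (r x) (kron (1\<^sub>m m) (p y))" for x y
  define c23 where "c23 x y = kron (1\<^sub>m n) (controlled (q x) (p y))" for x y
  have [simp]: "dim_row (c12 x y) = n * m * k" "dim_col (c12 x y) = n * m * k"
    "dim_row (c13 x y) = n * m * k" "dim_col (c13 x y) = n * m * k"
    "dim_row (c23 x y) = n * m * k" "dim_col (c23 x y) = n * m * k" for x y
    by (simp_all add: c12_def c13_def c23_def mult.assoc)
  have left: "controlled (kron (r x) (q x)) (p y) = c13 x y * c23 x y" if "x \<noteq> F2" "y \<noteq> F2" for x y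
  proof -
    have "kron (r x) (q x) = kron (r x) (1\<^sub>m m) * kron (1\<^sub>m n) (q x)"
      by (simp add: kron_mult_dim)
    then have "controlled (kron (r x) (q x)) (p y) =
        controlled (kron (r x) (1\<^sub>m m)) (p y) * controlled (kron (1\<^sub>m n) (q x)) (p y)"
      using that p.rel(1)[of y] by (simp add: controlled_mult_left[of _ "n * m" _ _ k])
    then show ?thesis by (simp add: c13_def c23_def controlled_kron[of _ n _ k] controlled_kron[of _ m _ k])
  qed
  have right: "controlled (r x) (kron (q y) (p y)) = c12 x y * c13 x y" if "x \<noteq> F2" for x y
  proof -
    have "kron (q y) (p y) = kron (q y) (1\<^sub>m k) * kron (1\<^sub>m m) (p y)"
      by (simp add: kron_mult_dim)
    then show ?thesis
      using that r.rel(1)[of x] by (simp add: c12_def c13_def controlled_mult_right[of _ n _ "m * k"])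
  qed
  have k12: "kron (bichar r q) (1\<^sub>m k) = c12 F5 F3 * c12 F4 F6"
    by (simp add: bichar_def c12_def controlled_kron[of _ n _ m] kron_mult_dim)
  have k23: "kron (1\<^sub>m n) (bichar q p) = c23 F5 F3 * c23 F4 F6"
    by (simp add: bichar_def c23_def kron_mult_dim)
  have comm1: "c13 x y * c12 x' y' = c12 x' y' * c13 x y"
    if "x \<in> {F3, F4, F5, F6}" "x' \<in> {F3, F4, F5, F6}" for x y x' y'
    unfolding c12_def c13_def using that r.abelian
    by (intro controlled_commute[of _ n _ _ "m * k"]) (auto simp: kron_mult_dim)
  have comm2: "c23 x y * c12 x' y' = c12 x' y' * c23 x y"
    if "x \<in> {F3, F4, F5, F6}" "y' \<in> {F3, F4, F5, F6}" for x y x' y'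
  proof -
    have "kron (q y') (1\<^sub>m k) * controlled (q x) (p y) = controlled (q x) (p y) * kron (q y') (1\<^sub>m k)"
      using that q.abelian by (intro controlled_intertwine) auto
    then show ?thesis
      unfolding c12_def c23_def by (intro controlled_intertwine) auto
  qed
  have comm3: "c23 x y * c13 x' y' = c13 x' y' * c23 x y"
    if "y \<in> {F3, F4, F5, F6}" "y' \<in> {F3, F4, F5, F6}" for x y x' y'
  proof -
    have "kron (1\<^sub>m m) (p y') * controlled (q x) (p y) = controlled (q x) (p y) * kron (1\<^sub>m m) (p y')"
      using that p.abelian by (intro controlled_intertwine) auto
    then show ?thesis
      unfolding c13_def c23_def by (intro controlled_intertwine) auto
  qed
  define a12 b12 a13 b13 a23 b23 where "a12 = c12 F5 F3" and "b12 = c12 F4 F6"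
    and "a13 = c13 F5 F3" and "b13 = c13 F4 F6" and "a23 = c23 F5 F3" and "b23 = c23 F4 F6"
  note abdefs = a12_def b12_def a13_def b13_def a23_def b23_def
  have [simp]: "dim_row a12 = n * m * k" "dim_col a12 = n * m * k" "dim_row b12 = n * m * k"
    "dim_col b12 = n * m * k" "dim_row a13 = n * m * k" "dim_col a13 = n * m * k"
    "dim_row b13 = n * m * k" "dim_col b13 = n * m * k" "dim_row a23 = n * m * k"
    "dim_col a23 = n * m * k" "dim_row b23 = n * m * k" "dim_col b23 = n * m * k"
    by (simp_all add: abdefs)
  have comm: "a23 * b13 = b13 * a23" "a23 * a12 = a12 * a23" "a23 * b12 = b12 * a23"
    "b23 * a12 = a12 * b23" "b23 * b12 = b12 * b23" "b13 * a12 = a12 * b13" "b13 * b12 = b12 * b13"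
    "a13 * a12 = a12 * a13"
    unfolding abdefs by (rule comm1 comm2 comm3; simp)+
  note comm' = comm comm[THEN commute_left]
  have "(a13 * a23) * (b13 * b23) * (a12 * b12) = (a12 * a13) * (b12 * b13) * (a23 * b23)"
    by (simp add: assoc_mult_mat_dim comm')
  then show ?thesis
    unfolding k12 k23 bichar_def[of "\<lambda>x. kron (r x) (q x)"] bichar_def[of r "\<lambda>x. kron (q x) (p x)"]
    by (simp add: left right abdefs)
qed

lemma bichar_one:
  assumes "gen_rep t n r"
  shows "bichar (\<lambda>x. 1\<^sub>m 1) r = 1\<^sub>m n" "bichar r (\<lambda>x. 1\<^sub>m 1) = 1\<^sub>m n"
proof -
  interpret gen_rep t n r by fact
  show "bichar (\<lambda>x. 1\<^sub>m 1) r = 1\<^sub>m n" "bichar r (\<lambda>x. 1\<^sub>m 1) = 1\<^sub>m n"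
    by (simp_all add: bichar_def controlled_one[of _ n])
qed


section \<open>The equivalence of representation categories\<close>

lemma Obj_Rep_iff:
  "(n, \<rho>) \<in> Obj (Rep G) \<longleftrightarrow> \<rho> \<in> hom G (unitary_group n) \<and> \<rho> \<in> extensional (carrier G)"
  by (simp add: Rep_def)

definition on_gens :: "bool \<Rightarrow> (gen gword set \<Rightarrow> complex mat) \<Rightarrow> gen \<Rightarrow> complex mat" where
  "on_gens t \<rho> x = \<rho> (gen_class (G_rels t) x)"

definition rep_of :: "bool \<Rightarrow> nat \<Rightarrow> (gen \<Rightarrow> complex mat) \<Rightarrow> gen gword set \<Rightarrow> complex mat" where
  "rep_of t n r = pres_lift (G_rels t) (unitary_group n) r"

lemma gen_rep_on_gens:
  assumes "(n, \<rho>) \<in> Obj (Rep (Gp t))"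
  shows "gen_rep t n (on_gens t \<rho>)"
proof
  have h: "\<rho> \<in> hom (Gp t) (unitary_group n)" using assms by (simp add: Obj_Rep_iff)
  then show "on_gens t \<rho> x \<in> carrier (unitary_group n)" for x
    by (auto simp: on_gens_def hom_def)
  show "satisfies_rels t (unitary_group n) (on_gens t \<rho>)"
    using satisfies_rels_hom[OF group_unitary_group h] by (simp add: on_gens_def[abs_def])
qed

text \<open>The universal property applied to the unitary group; with \<open>Obj_Rep_eqI\<close> it
  identifies objects with generator data.\<close>

lemma rep_of:
  assumes "gen_rep t n r"
  shows "(n, rep_of t n r) \<in> Obj (Rep (Gp t))" "on_gens t (rep_of t n r) = r"
proof -
  interpret gen_rep t n r by fact
  interpret U: group "unitary_group n" by (rule group_unitary_group)
  have r: "range r \<subseteq> carrier (unitary_group n)" using unitary by auto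
  have R: "\<forall>(u, v)\<in>G_rels t. word_val (unitary_group n) r u = word_val (unitary_group n) r v"
    using U.satisfies_rels_iff[OF r] rels by blast
  show "(n, rep_of t n r) \<in> Obj (Rep (Gp t))"
    using U.pres_lift_hom[OF r R] by (simp add: Obj_Rep_iff rep_of_def pres_lift_extensional)
  show "on_gens t (rep_of t n r) = r"
    using U.pres_lift_gen_class[OF r R] by (simp add: on_gens_def rep_of_def fun_eq_iff)
qed

text \<open>Intertwining passes from generators to their inverses by multiplying with the inverses
  on both sides, then to words by induction, and every group element is a word.\<close>

lemma Hom_Rep_iff:
  assumes "(n, \<rho>) \<in> Obj (Rep (Gp t))" "(m, \<sigma>) \<in> Obj (Rep (Gp t))"
  shows "T \<in> Hom (Rep (Gp t)) (n, \<rho>) (m, \<sigma>) \<longleftrightarrow>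
    dim_row T = m \<and> dim_col T = n \<and> (\<forall>x. T * on_gens t \<rho> x = on_gens t \<sigma> x * T)"
    (is "?L \<longleftrightarrow> ?R")
proof
  assume ?L
  then show ?R by (auto simp: Rep_def on_gens_def)
next
  assume R: ?R
  interpret r: gen_rep t n "on_gens t \<rho>" by (rule gen_rep_on_gens) fact
  interpret q: gen_rep t m "on_gens t \<sigma>" by (rule gen_rep_on_gens) fact
  interpret U: group "unitary_group n" by (rule group_unitary_group)
  interpret V: group "unitary_group m" by (rule group_unitary_group)
  let ?r = "on_gens t \<rho>" and ?q = "on_gens t \<sigma>"
  have dim: "dim_row T = m" "dim_col T = n" and T: "T * ?r x = ?q x * T" for x
    using R by auto
  have rc: "range ?r \<subseteq> carrier (unitary_group n)" and qc: "range ?q \<subseteq> carrier (unitary_group m)"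
    using r.unitary q.unitary by auto
  have inv: "T * inv\<^bsub>unitary_group n\<^esub> ?r x = inv\<^bsub>unitary_group m\<^esub> ?q x * T" for x
  proof -
    let ?a = "inv\<^bsub>unitary_group n\<^esub> ?r x" and ?b = "inv\<^bsub>unitary_group m\<^esub> ?q x"
    have a: "?r x * ?a = 1\<^sub>m n" and b: "?b * ?q x = 1\<^sub>m m"
      using U.r_inv[OF r.unitary] V.l_inv[OF q.unitary]
      by (simp_all add: unitary_group_mult unitary_group_one)
    have [simp]: "dim_row ?a = n" "dim_col ?a = n" "dim_row ?b = m" "dim_col ?b = m"
      using unitary_groupD(1,2)[OF U.inv_closed[OF r.unitary[of x]]]
        unitary_groupD(1,2)[OF V.inv_closed[OF q.unitary[of x]]] by simp_all
    have "T * ?a = (?b * ?q x) * T * ?a" using dim by (simp add: b)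
    also have "\<dots> = ?b * (?q x * T) * ?a" using dim by (simp add: assoc_mult_mat_dim)
    also have "\<dots> = ?b * (T * (?r x * ?a))" unfolding T[symmetric] using dim by (simp add: assoc_mult_mat_dim)
    also have "\<dots> = ?b * T" using dim by (simp add: a)
    finally show ?thesis .
  qed
  have word: "T * word_val (unitary_group n) ?r w = word_val (unitary_group m) ?q w * T" for w
  proof (induction w)
    case Nil
    then show ?case using dim by (simp add: unitary_group_one)
  next
    case (Cons p w)
    obtain x b where p: "p = (x, b)" by (cases p)
    define a where "a = (if b then ?r x else inv\<^bsub>unitary_group n\<^esub> ?r x)"
    define c where "c = (if b then ?q x else inv\<^bsub>unitary_group m\<^esub> ?q x)"
    have "a \<in> carrier (unitary_group n)" "c \<in> carrier (unitary_group m)"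
      using r.unitary q.unitary by (simp_all add: a_def c_def)
    note d = unitary_groupD(1,2)[OF this(1)] unitary_groupD(1,2)[OF this(2)]
      unitary_groupD(1,2)[OF U.word_val_closed[OF rc, of w]]
      unitary_groupD(1,2)[OF V.word_val_closed[OF qc, of w]]
    have ac: "T * a = c * T" using T inv by (simp add: a_def c_def)
    have "T * (a * word_val (unitary_group n) ?r w) = (T * a) * word_val (unitary_group n) ?r w"
      using dim d by (simp add: assoc_mult_mat_dim)
    also have "\<dots> = c * (T * word_val (unitary_group n) ?r w)"
      unfolding ac using dim d by (simp add: assoc_mult_mat_dim)
    also have "\<dots> = c * word_val (unitary_group m) ?q w * T"
      unfolding Cons.IH using dim d by (simp add: assoc_mult_mat_dim)
    finally show ?case by (simp add: p unitary_group_mult a_def c_def)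
  qed
  have "T * \<rho> X = \<sigma> X * T" if X: "X \<in> carrier (Gp t)" for X
  proof -
    obtain w where w: "X = pres_class (G_rels t) w" using X by (auto simp: presented_group_carrier)
    show ?thesis
      using word[of w] U.hom_presented_group_eq_word_val[of \<rho> "G_rels t" w]
        V.hom_presented_group_eq_word_val[of \<sigma> "G_rels t" w] assms
      by (simp add: w Obj_Rep_iff on_gens_def[abs_def])
  qed
  then show ?L using dim by (auto simp: Rep_def)
qed

text \<open>By \<open>Hom_Rep_iff\<close> the identity matrix is an intertwiner, so the
  representations agree on the carrier; extensionality fixes them elsewhere.\<close>

lemma Obj_Rep_eqI:
  assumes "(n, \<rho>) \<in> Obj (Rep (Gp t))" "(n, \<sigma>) \<in> Obj (Rep (Gp t))" "on_gens t \<rho> = on_gens t \<sigma>"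
  shows "\<rho> = \<sigma>"
proof -
  interpret r: gen_rep t n "on_gens t \<sigma>" by (rule gen_rep_on_gens) fact
  have "1\<^sub>m n \<in> Hom (Rep (Gp t)) (n, \<rho>) (n, \<sigma>)"
    using assms by (simp add: Hom_Rep_iff)
  then have h: "1\<^sub>m n * \<rho> X = \<sigma> X * 1\<^sub>m n" if "X \<in> carrier (Gp t)" for X
    using that by (simp add: Rep_def)
  have c: "\<rho> X \<in> carrier (unitary_group n)" "\<sigma> X \<in> carrier (unitary_group n)"
    if "X \<in> carrier (Gp t)" for X
    using assms that by (auto simp: Obj_Rep_iff hom_def)
  show ?thesis
  proof (rule extensionalityI[of _ "carrier (Gp t)"])
    show "\<rho> X = \<sigma> X" if "X \<in> carrier (Gp t)" for X
      using h[OF that] unitary_groupD(1,2)[OF c(1)[OF that]] unitary_groupD(1,2)[OF c(2)[OF that]]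
      by simp
  qed (use assms in \<open>simp_all add: Obj_Rep_iff\<close>)
qed

section \<open>The twist on objects and morphisms\<close>

definition twist :: "bool \<Rightarrow> complex \<Rightarrow> gen gword set urep \<Rightarrow> gen gword set urep" where
  "twist t s = (\<lambda>(n, \<rho>). (n, rep_of (\<not> t) n (twist_gen s (on_gens t \<rho>))))"

lemma twist_Obj:
  assumes "a \<in> Obj (Rep (Gp t))" "s * s = -1" "cnj s = - s"
  shows "twist t s a \<in> Obj (Rep (Gp (\<not> t)))"
    and "on_gens (\<not> t) (snd (twist t s a)) = twist_gen s (on_gens t (snd a))"
proof -
  obtain n \<rho> where a: "a = (n, \<rho>)" by (cases a)
  interpret gen_rep t n "on_gens t \<rho>" using assms(1) by (auto simp: a intro: gen_rep_on_gens)
  show "twist t s a \<in> Obj (Rep (Gp (\<not> t)))"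
    using rep_of(1)[OF twist_gen_rep[OF assms(2,3)]] by (simp add: twist_def a)
  show "on_gens (\<not> t) (snd (twist t s a)) = twist_gen s (on_gens t (snd a))"
    using rep_of(2)[OF twist_gen_rep[OF assms(2,3)]] by (simp add: twist_def a)
qed

lemma fst_twist [simp]: "fst (twist t s a) = fst a"
  by (simp add: twist_def split: prod.splits)

text \<open>An equality of objects and not only an isomorphism, because objects are determined by
  their generator images.\<close>

lemma twist_twist:
  assumes "a \<in> Obj (Rep (Gp t))" "s * s = -1" "cnj s = - s"
  shows "twist (\<not> t) (- s) (twist t s a) = a"
proof -
  have b: "twist t s a \<in> Obj (Rep (Gp (\<not> t)))" using twist_Obj[OF assms] by simp
  have c: "twist (\<not> t) (- s) (twist t s a) \<in> Obj (Rep (Gp t))"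
    using twist_Obj(1)[OF b, of "- s"] assms by simp
  obtain n \<rho> where a: "a = (n, \<rho>)" by (cases a)
  interpret gen_rep t n "on_gens t \<rho>" using assms(1) by (auto simp: a intro: gen_rep_on_gens)
  have "on_gens t (snd (twist (\<not> t) (- s) (twist t s a))) = on_gens t (snd a)"
    using twist_Obj(2)[OF b, of "- s"] twist_Obj(2)[OF assms] twist_gen_inverse[OF assms(2)] assms
    by (simp add: a)
  then have "snd (twist (\<not> t) (- s) (twist t s a)) = snd a"
    using Obj_Rep_eqI[of n "snd (twist (\<not> t) (- s) (twist t s a))" t "snd a"] c assms(1)
    by (metis a fst_conv fst_twist prod.collapse)
  then show ?thesis by (simp add: prod_eq_iff)
qed

text \<open>One inclusion holds for every flag and root \<open>s\<close>; applied to the inverse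
  twist it also gives the other. Hence the functor can be the identity on morphisms.\<close>

lemma twist_Hom:
  assumes "a \<in> Obj (Rep (Gp t))" "b \<in> Obj (Rep (Gp t))" "s * s = -1" "cnj s = - s"
  shows "Hom (Rep (Gp (\<not> t))) (twist t s a) (twist t s b) = Hom (Rep (Gp t)) a b"
proof -
  have sub: "Hom (Rep (Gp t)) a b \<subseteq> Hom (Rep (Gp (\<not> t))) (twist t s a) (twist t s b)"
    if "a \<in> Obj (Rep (Gp t))" "b \<in> Obj (Rep (Gp t))" "s * s = -1" "cnj s = - s" for t a b s
  proof
    fix T assume T: "T \<in> Hom (Rep (Gp t)) a b"
    obtain n \<rho> m \<sigma> where e: "a = (n, \<rho>)" "b = (m, \<sigma>)" by (cases a, cases b)
    obtain \<rho>' \<sigma>' where e': "twist t s a = (n, \<rho>')" "twist t s b = (m, \<sigma>')"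
      by (simp add: twist_def e)
    have "dim_row T = m" "dim_col T = n" "\<And>x. T * on_gens t \<rho> x = on_gens t \<sigma> x * T"
      using T Hom_Rep_iff[of n \<rho> t m \<sigma> T] that e by auto
    then have "T * twist_gen s (on_gens t \<rho>) x = twist_gen s (on_gens t \<sigma>) x * T" for x
      using that by (intro twist_gen_intertwine[of t n _ m] gen_rep_on_gens) (auto simp: e)
    then show "T \<in> Hom (Rep (Gp (\<not> t))) (twist t s a) (twist t s b)"
      using Hom_Rep_iff[of n \<rho>' "\<not> t" m \<sigma>' T] twist_Obj[OF that(1,3,4)] twist_Obj[OF that(2,3,4)]
        \<open>dim_row T = m\<close> \<open>dim_col T = n\<close> by (simp add: e e'[unfolded e])
  qed
  have "Hom (Rep (Gp (\<not> t))) (twist t s a) (twist t s b) \<subseteq>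
      Hom (Rep (Gp (\<not> \<not> t))) (twist (\<not> t) (- s) (twist t s a)) (twist (\<not> t) (- s) (twist t s b))"
    using assms twist_Obj(1) by (intro sub) auto
  then show ?thesis
    using sub[OF assms] assms by (simp add: twist_twist)
qed

section \<open>The unitary tensor structure\<close>

definition twist_J :: "bool \<Rightarrow> gen gword set urep \<Rightarrow> gen gword set urep \<Rightarrow> complex mat" where
  "twist_J t a b = bichar (on_gens t (snd a)) (on_gens t (snd b))"

lemma Rep_simps:
  "Id (Rep G) a = 1\<^sub>m (fst a)" "Comp (Rep G) = (*)" "Add (Rep G) = (+)" "Scale (Rep G) = (\<cdot>\<^sub>m)"
  "Adj (Rep G) = mat_adjoint" "TMor (Rep G) = kron" "Unit (Rep G) = (1, \<lambda>g\<in>carrier G. 1\<^sub>m 1)"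
  "fst (TObj (Rep G) a b) = fst a * fst b"
  "Assoc (Rep G) a b c = 1\<^sub>m (fst a * fst b * fst c)"
  "LUnit (Rep G) a = 1\<^sub>m (fst a)" "RUnit (Rep G) a = 1\<^sub>m (fst a)"
  by (simp_all add: Rep_def split: prod.splits)

lemma on_gens_TObj:
  "on_gens t (snd (TObj (Rep (Gp t)) a b)) = (\<lambda>x. kron (on_gens t (snd a) x) (on_gens t (snd b) x))"
  by (auto simp: on_gens_def Rep_def split: prod.splits)

lemma on_gens_Unit: "on_gens t (snd (Unit (Rep (Gp t)))) = (\<lambda>x. 1\<^sub>m 1)"
  by (auto simp: on_gens_def Rep_def)

lemma Unit_Rep_Obj:
  assumes "group G"
  shows "Unit (Rep G) \<in> Obj (Rep G)"
proof -
  interpret group G by fact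
  interpret U: group "unitary_group 1" by (rule group_unitary_group)
  show ?thesis
    using U.one_closed by (auto simp: Rep_simps Obj_Rep_iff hom_def unitary_group_mult unitary_group_one)
qed

lemma gen_rep_Obj: "a \<in> Obj (Rep (Gp t)) \<Longrightarrow> gen_rep t (fst a) (on_gens t (snd a))"
  by (rule gen_rep_on_gens) simp

text \<open>Associators and unitors are identity matrices and morphisms are unchanged, so coherence
  reduces to the cocycle identity and normalization of \<open>bichar\<close>, and naturality to
  \<open>bichar_natural\<close>.\<close>

lemma twist_unitary_tensor_functor:
  assumes s: "s * s = -1" "cnj s = - s"
  shows "unitary_tensor_functor (Rep (Gp t)) (Rep (Gp (\<not> t))) (twist t s) (\<lambda>a b T. T) (1\<^sub>m 1) (twist_J t)"
proof -
  let ?C = "Rep (Gp t)" and ?D = "Rep (Gp (\<not> t))" and ?F = "twist t s"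
  have TObjC: "TObj ?C a b \<in> Obj ?C" if "a \<in> Obj ?C" "b \<in> Obj ?C" for a b
    using that by (rule TObj_Rep) (rule group_presented_group)
  have TObjD: "TObj ?D a b \<in> Obj ?D" if "a \<in> Obj ?D" "b \<in> Obj ?D" for a b
    using that by (rule TObj_Rep) (rule group_presented_group)
  have UnitC: "Unit ?C \<in> Obj ?C" and UnitD: "Unit ?D \<in> Obj ?D"
    by (rule Unit_Rep_Obj, rule group_presented_group)+
  have FObj: "?F a \<in> Obj ?D" if "a \<in> Obj ?C" for a using twist_Obj(1)[OF that s] .
  have Fgens: "on_gens (\<not> t) (snd (?F a)) = twist_gen s (on_gens t (snd a))" if "a \<in> Obj ?C" for a
    using twist_Obj(2)[OF that s] .
  have HomD: "T \<in> Hom ?D x y \<longleftrightarrow> dim_row T = fst y \<and> dim_col T = fst x \<and>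
      (\<forall>z. T * on_gens (\<not> t) (snd x) z = on_gens (\<not> t) (snd y) z * T)"
    if "x \<in> Obj ?D" "y \<in> Obj ?D" for T x y
    using Hom_Rep_iff[of "fst x" "snd x" "\<not> t" "fst y" "snd y" T] that by simp
  have HomC: "T \<in> Hom ?C x y \<longleftrightarrow> dim_row T = fst y \<and> dim_col T = fst x \<and>
      (\<forall>z. T * on_gens t (snd x) z = on_gens t (snd y) z * T)"
    if "x \<in> Obj ?C" "y \<in> Obj ?C" for T x y
    using Hom_Rep_iff[of "fst x" "snd x" t "fst y" "snd y" T] that by simp
  have two: "two_gen_reps t (fst a) (on_gens t (snd a)) (fst b) (on_gens t (snd b))"
    if "a \<in> Obj ?C" "b \<in> Obj ?C" for a b
    using that by (intro two_gen_reps.intro gen_rep_Obj)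
  have [simp]: "dim_row (twist_J t a b) = fst a * fst b" "dim_col (twist_J t a b) = fst a * fst b"
    if "a \<in> Obj ?C" "b \<in> Obj ?C" for a b
    using two_gen_reps.dim_bichar[OF two[OF that]] by (simp_all add: twist_J_def)
  have J_one: "twist_J t (Unit ?C) a = 1\<^sub>m (fst a)" "twist_J t a (Unit ?C) = 1\<^sub>m (fst a)"
    if "a \<in> Obj ?C" for a
    using bichar_one[OF gen_rep_Obj[OF that]] by (simp_all add: twist_J_def on_gens_Unit)
  have star_fun: "star_functor ?C ?D ?F (\<lambda>a b T. T)"
    unfolding star_functor_def using FObj s by (auto simp: Rep_simps twist_Hom)
  \<comment> \<open>The trivial representation stays trivial because the phase of an identity matrix
    is the identity.\<close>
  have unit_mor: "unitary_mor ?D (Unit ?D) (?F (Unit ?C)) (1\<^sub>m 1)"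
    unfolding unitary_mor_def HomD[OF UnitD FObj[OF UnitC]] Fgens[OF UnitC] on_gens_Unit
    by (simp add: Rep_simps mat_adjoint_one twist_gen_def phase_one)
  have J_mor: "unitary_mor ?D (TObj ?D (?F a) (?F b)) (?F (TObj ?C a b)) (twist_J t a b)"
    if ab: "a \<in> Obj ?C" "b \<in> Obj ?C" for a b
  proof -
    interpret two_gen_reps t "fst a" "on_gens t (snd a)" "fst b" "on_gens t (snd b)"
      by (rule two[OF ab])
    show ?thesis
      unfolding unitary_mor_def HomD[OF TObjD[OF FObj[OF ab(1)] FObj[OF ab(2)]] FObj[OF TObjC[OF ab]]]
        Fgens[OF TObjC[OF ab]] on_gens_TObj Fgens[OF ab(1)] Fgens[OF ab(2)]
      using bichar_unitary bichar_intertwine[OF s(1)] by (simp add: Rep_simps twist_J_def)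
  qed
  have J_nat: "twist_J t a' b' * kron f g = kron f g * twist_J t a b"
    if "a \<in> Obj ?C" "b \<in> Obj ?C" "a' \<in> Obj ?C" "b' \<in> Obj ?C" "f \<in> Hom ?C a a'" "g \<in> Hom ?C b b'"
    for a b a' b' f g
    unfolding twist_J_def
    by (rule bichar_natural[OF two[OF that(1,2)] two[OF that(3,4)]])
      (use that in \<open>auto simp: HomC\<close>)
  have J_cocycle: "twist_J t (TObj ?C a b) c * kron (twist_J t a b) (1\<^sub>m (fst c)) =
      twist_J t a (TObj ?C b c) * kron (1\<^sub>m (fst a)) (twist_J t b c)"
    if "a \<in> Obj ?C" "b \<in> Obj ?C" "c \<in> Obj ?C" for a b c
    unfolding twist_J_def on_gens_TObj by (rule bichar_cocycle[OF that[THEN gen_rep_Obj]])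
  show ?thesis
    unfolding unitary_tensor_functor_def
    using star_fun unit_mor J_mor J_nat J_cocycle J_one
    by (auto simp: Rep_simps(1-6,8-) TObjC mult.assoc kron_one kron_one_left kron_one_right)
qed

lemma monoidally_equivalent_Gp: "monoidally_equivalent (Gp t) (Gp (\<not> t))"
proof -
  \<comment> \<open>Both \<open>\<i>\<close> and \<open>- \<i>\<close> satisfy the assumptions on
    the root, so the twist and its inverse are available.\<close>
  have s: "\<i> * \<i> = -1" "cnj \<i> = - \<i>" "- \<i> * - \<i> = -1" "cnj (- \<i>) = - (- \<i>)" by simp_all
  have "\<exists>x\<in>Obj (Rep (Gp t)). \<exists>u. unitary_mor (Rep (Gp (\<not> t))) (twist t \<i> x) y u"
    if y: "y \<in> Obj (Rep (Gp (\<not> t)))" for y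
  proof (intro bexI exI)
    \<comment> \<open>The preimage is the inverse twist; it is mapped to \<open>y\<close> itself, so
      the identity matrix is the required unitary.\<close>
    show "twist (\<not> t) (- \<i>) y \<in> Obj (Rep (Gp t))"
      using twist_Obj(1)[OF y s(3,4)] by simp
    have "twist t \<i> (twist (\<not> t) (- \<i>) y) = y"
      using twist_twist[OF y s(3,4)] by simp
    then show "unitary_mor (Rep (Gp (\<not> t))) (twist t \<i> (twist (\<not> t) (- \<i>) y)) y (1\<^sub>m (fst y))"
      using Hom_Rep_iff[of "fst y" "snd y" "\<not> t" "fst y" "snd y"] y gen_rep.dim[OF gen_rep_Obj[OF y]]
      by (simp add: unitary_mor_def Rep_simps mat_adjoint_one)
  qed
  moreover have "bij_betw (\<lambda>T. T) (Hom (Rep (Gp t)) a b)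
      (Hom (Rep (Gp (\<not> t))) (twist t \<i> a) (twist t \<i> b))"
    if "a \<in> Obj (Rep (Gp t))" "b \<in> Obj (Rep (Gp t))" for a b
    using twist_Hom[OF that s(1,2)] by (simp add: bij_betw_def)
  ultimately show ?thesis
    unfolding monoidally_equivalent_def unitarily_monoidally_equivalent_def
    using twist_unitary_tensor_functor[OF s(1,2)] by blast
qed

theorem theorem6p3:
  shows "group G3 \<and> Coset.order G3 = 64 \<and> group G4 \<and> Coset.order G4 = 64 \<and>
    \<not> G3 \<cong> G4 \<and>
    monoidally_equivalent G3 G4 \<and>
    order_list G3 = [1, 31, 32, 0, 0, 0, 0] \<and>
    order_list G4 = [1, 31, 32, 0, 0, 0, 0]"
proof -
  have iso: "Gp t \<cong> bits_group t" for t
    using to_bits_iso by (rule is_isoI)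
  have order: "Coset.order (Gp t) = 64" for t
    using iso_same_card[OF iso] order_bits_group[of t] by (simp add: Coset.order_def)
  have list: "order_list (Gp t) = [1, 31, 32, 0, 0, 0, 0]" for t
    using order_list_iso[OF group_presented_group group_bits_group to_bits_iso]
      order_list_bits_group[of t] by simp
  have not_iso: "\<not> Gp False \<cong> Gp True"
  proof
    assume "Gp False \<cong> Gp True"
    with group.iso_sym[OF group_presented_group iso] have "bits_group False \<cong> Gp True"
      by (rule iso_trans)
    then have "bits_group False \<cong> bits_group True"
      using iso by (rule iso_trans)
    with not_iso_bits_group show False by (rule notE)
  qed
  have equiv: "monoidally_equivalent (Gp False) (Gp True)"
    using monoidally_equivalent_Gp[of False] by simp
  show ?thesis
    by (simp only: G3_eq G4_eq group_presented_group order list not_iso equiv simp_thms)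
qed

end
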